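(* Let $p$ be an odd prime. Then $$\sum_{n=0}^{p-1}\frac{V_n}{8^n}\equiv\sum_{n=0}^{p-1}\frac{V_n}{32^n}\equiv\begin{cases}4x^2\pmod p&\text{if } p\equiv1\pmod4\text{ and }p=x^2+4y^2\ (x,y\in\mathbb{Z}),\\0\pmod p&\text{if }p\equiv3\pmod4,\end{cases}$$ and $$\sum_{n=0}^{p-1}\frac{V_n}{(-16)^n}\equiv\begin{cases}4x^2-2p\pmod{p^2}&\text{if } p\equiv1\pmod4\text{ and }p=x^2+4y^2\ (x,y\in\mathbb{Z}),\\0\pmod p&\text{if }p\equiv3\pmod4.\end{cases}$$
   Context: For $n\ge0$, $V_n=\sum_{k=0}^n\binom{2k}{k}^2\binom{2n-2k}{n-k}^2$. Congruences between rationals with denominators prime to $p$ are taken in the ring of such rationals. *)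

theory Defs
  imports Complex_Main "HOL-Computational_Algebra.Primes"
begin

definition V :: "nat \<Rightarrow> nat" where
  "V n = (\<Sum>k\<le>n. ((2 * k) choose k)\<^sup>2 * ((2 * n - 2 * k) choose (n - k))\<^sup>2)"

text \<open>The ring of rationals whose (reduced) denominator is prime to \<open>p\<close>.\<close>

definition p_integers :: "nat \<Rightarrow> rat set" where
  "p_integers p = {r. coprime (snd (quotient_of r)) (int p)}"

text \<open>Congruence modulo \<open>p ^ k\<close> in the ring \<open>p_integers p\<close>: both sides lie in
  the ring, and their difference lies in the ideal generated by \<open>p ^ k\<close>.
  The library's \<open>cong\<close> does not serve here: on \<open>rat\<close>, with the instance from
  \<open>Field_as_Ring\<close>, it refers to the trivial division with remainder of a field.\<close>

definition rat_cong :: "nat \<Rightarrow> nat \<Rightarrow> rat \<Rightarrow> rat \<Rightarrow> bool" where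
  "rat_cong p k a b \<longleftrightarrow>
     a \<in> p_integers p \<and> b \<in> p_integers p \<and>
     (\<exists>c \<in> p_integers p. a - b = of_nat (p ^ k) * c)"

definition V_sum :: "nat \<Rightarrow> int \<Rightarrow> rat" where
  "V_sum p m = (\<Sum>n = 0..p - 1. of_nat (V n) / of_int m ^ n)"

end

theory Submission
  imports Defs "HOL-Number_Theory.Number_Theory" "HOL-Computational_Algebra.Formal_Laurent_Series"
begin

text \<open>
  Write \<open>p = 2n + 1\<close> and let \<open>D = (\<Sum>k\<le>n. C(n,k) C(n+k,k)) = (\<Sum>k\<le>n. C(n,k)\<^sup>2 2^k)\<close>.
  Since \<open>p\<close> divides \<open>C(2k,k)\<close> for \<open>n < k < p\<close>, the sum of \<open>V\<^sub>i / m^i\<close> over \<open>i < p\<close> is, modulo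
  \<open>p\<^sup>2\<close>, the square of the sum of \<open>C(2k,k)\<^sup>2 / m^k\<close> over \<open>k \<le> n\<close>. This square is congruent to \<open>D\<^sup>2\<close>,
  modulo \<open>p\<close> for \<open>m = 8, 32\<close> and modulo \<open>p\<^sup>2\<close> for \<open>m = -16\<close>. If \<open>n\<close> is odd, \<open>D\<close> is modulo \<open>p\<close> an
  alternating sum that vanishes by symmetry.

  If \<open>p = 4h + 1\<close>, then \<open>D\<close> is compared with the Jacobsthal sum \<open>T = (\<Sum>t. \<chi>(t) \<chi>(t\<^sup>2 - 1))\<close>,
  which satisfies \<open>T\<^sup>2 = 4x\<^sup>2\<close>. Replacing \<open>t\<close> by \<open>t^p\<close> and \<open>2\<chi>(a)\<close> by \<open>3a^n - a^(3n)\<close> turns \<open>2T\<close>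
  modulo \<open>p\<^sup>2\<close> into a combination of \<open>C(2h,h)\<close>, \<open>C(6h,h)\<close> and \<open>C(6h,3h)\<close>, which yields
  \<open>T D \<equiv> - (D\<^sup>2 + p)\<close> and hence \<open>D\<^sup>2 \<equiv> T\<^sup>2 - 2p\<close> modulo \<open>p\<^sup>2\<close>.
\<close>

section \<open>Congruences between rationals\<close>

text \<open>The reduced denominator divides every other denominator of the same rational, so
  coprimality to \<open>p\<close> passes down from \<open>b\<close>.\<close>

lemma p_integers_fraction:
  fixes a b :: int
  assumes "coprime b (int p)" and "b \<noteq> 0"
  shows "of_int a / of_int b \<in> p_integers p"
proof -
  obtain c d where q: "quotient_of (of_int a / of_int b) = (c, d)"
    by fastforce
  have d: "d > 0" "coprime c d"
    using q quotient_of_denom_pos quotient_of_coprime by auto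
  have "(of_int a / of_int b :: rat) = of_int c / of_int d"
    using quotient_of_div[OF q] .
  hence "(of_int (a * d) :: rat) = of_int (c * b)"
    using d(1) assms(2) by (simp add: field_simps)
  hence "a * d = c * b"
    using of_int_eq_iff by blast
  hence "d dvd c * b"
    by (metis dvd_triv_right)
  hence "d dvd b"
    using d(2) coprime_dvd_mult_right_iff[of d c b] coprime_commute by blast
  hence "coprime d (int p)"
    using assms(1) coprime_divisors[of d b "int p" "int p"] by simp
  thus ?thesis
    by (simp add: p_integers_def q)
qed

text \<open>Cross-multiplication: the bridge to \<open>rat_cong\<close> from integer congruences, in
  which the arithmetic is done.\<close>

lemma rat_cong_fractionI:
  fixes A B M N :: int
  assumes "coprime M (int p)" "M \<noteq> 0" "coprime N (int p)" "N \<noteq> 0"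
    and "[A * N = B * M] (mod (int p ^ k))"
  shows "rat_cong p k (of_int A / of_int M) (of_int B / of_int N)"
proof -
  obtain c where c: "A * N - B * M = int p ^ k * c"
    using assms(5) by (auto simp: cong_iff_dvd_diff)
  have "of_int A / of_int M - (of_int B / of_int N :: rat)
      = of_int (A * N - B * M) / of_int (M * N)"
    using assms by (simp add: field_simps)
  also have "\<dots> = of_nat (p ^ k) * (of_int c / of_int (M * N))"
    unfolding c by simp
  finally have *: "of_int A / of_int M - (of_int B / of_int N :: rat)
      = of_nat (p ^ k) * (of_int c / of_int (M * N))" .
  have "of_int c / of_int (M * N) \<in> p_integers p"
    using assms by (intro p_integers_fraction) auto
  thus ?thesis
    unfolding rat_cong_def using * assms p_integers_fraction by blast
qed

section \<open>Binomial sums and sums of two squares\<close>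

lemma square_power_mult: "(a ^ n * b)\<^sup>2 = a ^ (2 * n) * b\<^sup>2" for a b :: int
  by (simp add: power_mult_distrib power_even_eq)

lemma sum_atMost_rev: "(\<Sum>k\<le>n. f k) = (\<Sum>k\<le>n. f (n - k))" for n :: nat
  by (rule sum.reindex_bij_witness[of _ "\<lambda>k. n - k" "\<lambda>k. n - k"]) auto

lemma Suc_times_central_binomial:
  "Suc k * ((2 * Suc k) choose Suc k) = 2 * (2 * k + 1) * ((2 * k) choose k)"
proof -
  have "Suc k * ((2 * k + 1) choose k) = (2 * k + 1) * ((2 * k) choose k)"
    using Suc_times_binomial[of k "2 * k"] binomial_symmetric[of k "2 * k + 1"] by simp
  thus ?thesis
    using Suc_times_binomial[of k "2 * k + 1"] by simp
qed

lemma Suc_times_binomial_int: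
  "int (Suc k) * int (n choose Suc k) = (int n - int k) * int (n choose k)"
proof (cases "k \<le> n")
  case True
  thus ?thesis
    using binomial_absorb_comp[of n k] binomial_absorption[of k n]
    by (metis of_nat_diff of_nat_mult)
qed (simp add: binomial_eq_0)

text \<open>The left side is a sum over the triangle i + j \<le> 2n. The square i, j \<le> n lies
  inside it and gives the right side; every other pair has an index above \<open>n\<close>, hence a
  factor divisible by \<open>q\<close>.\<close>

lemma truncated_square_cong:
  fixes c :: "nat \<Rightarrow> int"
  assumes "\<And>k. n < k \<Longrightarrow> k \<le> 2 * n \<Longrightarrow> q dvd c k"
  shows "[(\<Sum>i\<le>2 * n. (\<Sum>k\<le>i. c k * c (i - k)) * m ^ (2 * n - i)) =
          (\<Sum>k\<le>n. c k * m ^ (n - k))\<^sup>2] (mod q)"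
proof -
  define g where "g i j = c i * c j * m ^ (2 * n - (i + j))" for i j
  have "(\<Sum>i\<le>2 * n. (\<Sum>k\<le>i. c k * c (i - k)) * m ^ (2 * n - i)) =
        (\<Sum>i\<le>2 * n. \<Sum>k\<le>i. g k (i - k))"
    by (simp add: g_def sum_distrib_right)
  also have "\<dots> = (\<Sum>(i, j)\<in>{(i, j). i + j \<le> 2 * n}. g i j)"
    by (rule sum.triangle_reindex_eq[symmetric])
  also have "\<dots> = (\<Sum>(i, j)\<in>{..n} \<times> {..n}. g i j) +
       (\<Sum>(i, j)\<in>{(i, j). i + j \<le> 2 * n} - {..n} \<times> {..n}. g i j)"
    by (subst sum.subset_diff[of "{..n} \<times> {..n}"])
       (auto intro: finite_subset[of _ "{..2 * n} \<times> {..2 * n}"])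
  also have "[\<dots> = (\<Sum>(i, j)\<in>{..n} \<times> {..n}. g i j) + 0] (mod q)"
  proof (intro cong_add cong_refl, unfold cong_0_iff, rule dvd_sum)
    fix x assume x: "x \<in> {(i, j). i + j \<le> 2 * n} - {..n} \<times> {..n}"
    obtain i j where ij: "x = (i, j)"
      by force
    have "i + j \<le> 2 * n" "\<not> (i \<le> n \<and> j \<le> n)"
      using x ij by auto
    hence "n < i \<and> i \<le> 2 * n \<or> n < j \<and> j \<le> 2 * n"
      by linarith
    hence "q dvd c i \<or> q dvd c j"
      using assms by blast
    thus "q dvd (case x of (i, j) \<Rightarrow> g i j)"
      by (auto simp: g_def ij)
  qed
  also have "(\<Sum>(i, j)\<in>{..n} \<times> {..n}. g i j) = (\<Sum>k\<le>n. c k * m ^ (n - k))\<^sup>2"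
    unfolding power2_eq_square sum_product sum.cartesian_product
  proof (intro sum.cong refl, clarify, goal_cases)
    case (1 i j)
    hence "2 * n - (i + j) = (n - i) + (n - j)"
      by auto
    thus ?case
      by (simp only: g_def power_add) simp
  qed
  finally show ?thesis
    by simp
qed

text \<open>Expand \<open>2 ^ k\<close> as the sum of C(k,j), exchange the sums, use C(n,k) C(k,j) =
  C(n,j) C(n-j,k-j), and sum over \<open>k\<close> by Vandermonde.\<close>

lemma sum_binomial_square_power_two:
  "(\<Sum>k\<le>n. (n choose k)\<^sup>2 * 2 ^ k) = (\<Sum>k\<le>n. (n choose k) * ((n + k) choose k))"
proof -
  have "(\<Sum>k\<le>n. (n choose k)\<^sup>2 * 2 ^ k) = (\<Sum>k\<le>n. \<Sum>j\<le>n. (n choose k)\<^sup>2 * (k choose j))"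
  proof (intro sum.cong refl)
    fix k assume "k \<in> {..n}"
    hence "(\<Sum>j\<le>n. k choose j) = (\<Sum>j\<le>k. k choose j)"
      by (intro sum.mono_neutral_right) auto
    thus "(n choose k)\<^sup>2 * 2 ^ k = (\<Sum>j\<le>n. (n choose k)\<^sup>2 * (k choose j))"
      by (simp add: choose_row_sum flip: sum_distrib_left)
  qed
  also have "\<dots> = (\<Sum>j\<le>n. \<Sum>k\<le>n. (n choose k)\<^sup>2 * (k choose j))"
    by (rule sum.swap)
  also have "\<dots> = (\<Sum>j\<le>n. (n choose j) * ((n + (n - j)) choose n))"
  proof (intro sum.cong refl)
    fix j assume "j \<in> {..n}"
    hence j: "j \<le> n" by simp
    have "(\<Sum>k\<le>n. (n choose k)\<^sup>2 * (k choose j)) =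
          (n choose j) * (\<Sum>k\<le>n. (n choose k) * ((n - j) choose (n - k)))"
      unfolding sum_distrib_left
    proof (intro sum.cong refl)
      fix k assume "k \<in> {..n}"
      hence k: "k \<le> n" by simp
      show "(n choose k)\<^sup>2 * (k choose j) = (n choose j) * ((n choose k) * ((n - j) choose (n - k)))"
      proof (cases "j \<le> k")
        case True
        hence "(n - j) choose (n - k) = (n - j) choose (k - j)"
          using k binomial_symmetric[of "n - k" "n - j"] by simp
        thus ?thesis
          using choose_mult[OF True k] by (simp add: power2_eq_square algebra_simps)
      qed (use k j in \<open>auto simp: binomial_eq_0\<close>)
    qed
    thus "(\<Sum>k\<le>n. (n choose k)\<^sup>2 * (k choose j)) = (n choose j) * ((n + (n - j)) choose n)"
      by (simp add: vandermonde[of n "n - j" n])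
  qed
  also have "\<dots> = (\<Sum>k\<le>n. (n choose (n - k)) * ((n + (n - (n - k))) choose n))"
    by (rule sum_atMost_rev)
  also have "\<dots> = (\<Sum>k\<le>n. (n choose k) * ((n + k) choose k))"
  proof (intro sum.cong refl arg_cong2[of _ _ _ _ "(*)"])
    fix k assume "k \<in> {..n}"
    thus "n choose (n - k) = n choose k" "(n + (n - (n - k))) choose n = (n + k) choose k"
      using binomial_symmetric[of k n] binomial_symmetric[of k "n + k"] by auto
  qed
  finally show ?thesis .
qed

section \<open>Alternating convolutions of binomial coefficients by formal power series\<close>

context
  includes fps_syntax
begin

text \<open>This is (1+X)^a (1-X)^a = (1-X^2)^a. It is immediate for natural exponents and passes to
  negative ones by taking inverses.\<close>

lemma fps_binomial_mult_reflection:
  fixes a :: "'a :: field_char_0"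
  assumes "a = of_nat N \<or> a = - of_nat N"
  shows "fps_binomial a * (fps_binomial a oo - fps_X) = fps_binomial a oo - (fps_X ^ 2)"
proof -
  define B :: "'a fps" where "B = (1 + fps_X) ^ N"
  have compose: "B oo g = (1 + g) ^ N" if "g $ 0 = 0" for g
    unfolding B_def using that
    by (simp add: fps_compose_power[symmetric] fps_compose_add_distrib)
  have B: "B * (B oo - fps_X) = B oo - (fps_X ^ 2)"
    by (simp add: compose, simp add: B_def power2_eq_square algebra_simps flip: power_mult_distrib)
  have "B $ 0 \<noteq> 0"
    by (simp add: B_def fps_power_zeroth)
  hence "inverse B * (inverse B oo - fps_X) = inverse B oo - (fps_X ^ 2)"
    using B by (simp add: fps_inverse_compose flip: fps_inverse_mult)
  thus ?thesis
    using assms B by (auto simp: fps_binomial_of_nat fps_binomial_minus_of_nat B_def)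
qed

text \<open>Compare the coefficients of X^(2h) in the reflection identity.\<close>

lemma gbinomial_alternating_convolution:
  fixes a :: "'a :: field_char_0"
  assumes "a = of_nat N \<or> a = - of_nat N"
  shows "(\<Sum>k\<le>2 * h. (-1) ^ k * (a gchoose k) * (a gchoose (2 * h - k))) = (-1) ^ h * (a gchoose h)"
proof -
  have "(\<Sum>k\<le>2 * h. (-1) ^ k * (a gchoose k) * (a gchoose (2 * h - k))) =
        ((fps_binomial a oo - fps_X) * fps_binomial a) $ (2 * h)"
    by (simp add: fps_mult_nth atLeast0AtMost fps_compose_uminus')
  also have "\<dots> = (fps_binomial a oo - (fps_X ^ 2)) $ (2 * h)"
    by (simp only: fps_binomial_mult_reflection[OF assms] mult.commute[of "_ oo _"])
  also have "fps_binomial a oo - (fps_X ^ 2) = (fps_binomial a oo - fps_X) oo fps_X ^ 2"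
    by (subst fps_compose_assoc[symmetric])
       (simp_all add: fps_compose_uminus fps_X_fps_compose_startby0)
  also have "\<dots> $ (2 * h) = (-1) ^ h * (a gchoose h)"
    by (simp add: fps_nth_compose_X_power fps_compose_uminus')
  finally show ?thesis .
qed

lemma binomial_alternating_convolution:
  "(\<Sum>k\<le>2 * h. (-1) ^ k * int (N choose k) * int (N choose (2 * h - k))) = (-1) ^ h * int (N choose h)"
proof -
  have "(of_int (\<Sum>k\<le>2 * h. (-1) ^ k * int (N choose k) * int (N choose (2 * h - k))) :: rat) =
        of_int ((-1) ^ h * int (N choose h))"
    using gbinomial_alternating_convolution[of "of_nat N :: rat" N h]
    by (simp add: binomial_gbinomial)
  thus ?thesis
    by (simp only: of_int_eq_iff)
qed

text \<open>The case a = -(N+1): here C(-(N+1),k) = (-1)^k C(N+k,k), and the signs from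
  \<open>k\<close> and \<open>2 * h - k\<close> cancel.\<close>

lemma multiset_binomial_alternating_convolution:
  "(\<Sum>k\<le>2 * h. (-1) ^ k * int ((N + k) choose k) * int ((N + (2 * h - k)) choose (2 * h - k))) =
   int ((N + h) choose h)"
proof -
  have neg: "(- of_nat (Suc N) gchoose k :: rat) = (-1) ^ k * of_nat ((N + k) choose k)" for k
    using gbinomial_minus[of "of_nat (Suc N) :: rat" k] by (simp add: binomial_gbinomial)
  have "(of_int (\<Sum>k\<le>2 * h. (-1) ^ k * int ((N + k) choose k) *
      int ((N + (2 * h - k)) choose (2 * h - k))) :: rat) =
      (\<Sum>k\<le>2 * h. (-1) ^ k * (- of_nat (Suc N) gchoose k) * (- of_nat (Suc N) gchoose (2 * h - k)))"
    unfolding of_int_sum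
  proof (intro sum.cong refl)
    fix k assume "k \<in> {..2 * h}"
    hence "(-1) ^ (2 * h - k) = ((-1) ^ k :: rat)"
      by (auto simp: minus_one_power_iff)
    moreover have "(-1) ^ k * ((-1) ^ k * x) = x" for x :: rat
      by (simp flip: mult.assoc power_mult_distrib)
    ultimately show "of_int ((-1) ^ k * int ((N + k) choose k) *
        int ((N + (2 * h - k)) choose (2 * h - k))) =
        (-1) ^ k * (- of_nat (Suc N) gchoose k) * (- of_nat (Suc N) gchoose (2 * h - k) :: rat)"
      by (simp only: neg) (simp add: mult.left_commute mult.assoc)
  qed
  also have "\<dots> = of_int (int ((N + h) choose h))"
    using gbinomial_alternating_convolution[of "- of_nat (Suc N) :: rat" "Suc N" h]
    by (simp only: neg) (simp add: power_mult_distrib[symmetric] flip: mult.assoc)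
  finally show ?thesis
    by (simp only: of_int_eq_iff)
qed

end

text \<open>A polynomial in \<open>q * y\<close> may be cut off after its linear term. Since
  \<open>a\<close> and \<open>b\<close> do not depend on \<open>y\<close>, values at several
  \<open>y\<close> can be compared.\<close>

lemma prod_cong_linear:
  fixes q :: int and h :: nat
  shows "\<exists>a b. \<forall>y. [(\<Prod>j<h. q * y - r j) = a + b * (q * y)] (mod q\<^sup>2)"
proof (induction h)
  case 0
  show ?case
    by (rule exI[of _ 1], rule exI[of _ 0]) simp
next
  case (Suc h)
  then obtain a b where ab: "[(\<Prod>j<h. q * y - r j) = a + b * (q * y)] (mod q\<^sup>2)" for y
    by blast
  have "[(\<Prod>j<Suc h. q * y - r j) = - a * r h + (a - b * r h) * (q * y)] (mod q\<^sup>2)" for y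
  proof -
    have "[(\<Prod>j<h. q * y - r j) * (q * y - r h) = (a + b * (q * y)) * (q * y - r h)] (mod q\<^sup>2)"
      using ab by (intro cong_mult cong_refl)
    also have "[(a + b * (q * y)) * (q * y - r h) = - a * r h + (a - b * r h) * (q * y)] (mod q\<^sup>2)"
      unfolding cong_iff_dvd_diff
      by (intro dvdI[of _ _ "b * y\<^sup>2"]) (simp add: algebra_simps power2_eq_square)
    finally show ?thesis
      by simp
  qed
  thus ?case
    by blast
qed

lemma prod_eq_fact_times_binomial:
  "(\<Prod>j<h. 2 * int m - 2 * int j) = 2 ^ h * fact h * int (m choose h)"
proof (induction h)
  case (Suc h)
  have "(\<Prod>j<Suc h. 2 * int m - 2 * int j) = 2 ^ h * fact h * (2 * ((int m - int h) * int (m choose h)))"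
    unfolding prod.lessThan_Suc Suc by (simp add: right_diff_distrib left_diff_distrib)
  also have "\<dots> = 2 ^ h * fact h * (2 * (int (Suc h) * int (m choose Suc h)))"
    by (simp only: Suc_times_binomial_int)
  finally show ?case
    by (simp only: fact_Suc power_Suc mult_ac)
qed simp

text \<open>\<open>q\<close> divides (ad - bc)(-ad - bc), hence one of the factors. If that factor
  is nonzero, Brahmagupta's identity forces the companion ac + bd (with the sign of \<open>d\<close>
  adjusted) to vanish, although it is odd.\<close>

lemma prime_sum_two_squares_unique:
  fixes q a b c d :: int
  assumes "prime q" and ab: "q = a\<^sup>2 + b\<^sup>2" and cd: "q = c\<^sup>2 + d\<^sup>2"
    and "odd q" "odd a" "odd c"
  shows "a\<^sup>2 = c\<^sup>2"
proof -
  have "odd (a\<^sup>2 + b\<^sup>2)" "odd (c\<^sup>2 + d\<^sup>2)"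
    using ab cd \<open>odd q\<close> by simp_all
  hence even: "even b" "even d"
    using \<open>odd a\<close> \<open>odd c\<close> by simp_all
  \<comment> \<open>Here \<open>d'\<close> stands for \<open>d\<close> or \<open>- d\<close>, so
    that one argument covers both factors.\<close>
  have key: "a\<^sup>2 = c\<^sup>2" if "q dvd a * d' - b * c" and d': "d'\<^sup>2 = d\<^sup>2" for d'
  proof (cases "a * d' - b * c = 0")
    case True
    hence "(a * d')\<^sup>2 = (b * c)\<^sup>2"
      by simp
    hence "a\<^sup>2 * d\<^sup>2 = b\<^sup>2 * c\<^sup>2"
      by (simp only: power_mult_distrib d')
    moreover have "d\<^sup>2 = q - c\<^sup>2" "b\<^sup>2 = q - a\<^sup>2"
      using ab cd by simp_all
    ultimately have "a\<^sup>2 * (q - c\<^sup>2) = (q - a\<^sup>2) * c\<^sup>2"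
      by simp
    hence "q * (a\<^sup>2 - c\<^sup>2) = 0"
      by (simp add: algebra_simps)
    thus ?thesis
      using prime_gt_0_int[OF \<open>prime q\<close>] by simp
  next
    case False
    have "(a * c + b * d')\<^sup>2 + (a * d' - b * c)\<^sup>2 = (a\<^sup>2 + b\<^sup>2) * (c\<^sup>2 + d'\<^sup>2)"
      by (simp add: power2_eq_square algebra_simps)
    also have "\<dots> = q\<^sup>2"
      using ab cd d' by (simp add: power2_eq_square)
    finally have sum: "(a * c + b * d')\<^sup>2 + (a * d' - b * c)\<^sup>2 = q\<^sup>2" .
    have "q \<le> \<bar>a * d' - b * c\<bar>"
      using that(1) False by (intro zdvd_imp_le) auto
    hence "q\<^sup>2 \<le> (a * d' - b * c)\<^sup>2"
      using prime_gt_0_int[OF \<open>prime q\<close>] abs_le_square_iff[of q "a * d' - b * c"] by simp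
    hence "(a * c + b * d')\<^sup>2 \<le> 0"
      using sum by linarith
    hence "a * c + b * d' = 0"
      by simp
    moreover have "odd (a * c + b * d')"
      using assms even by simp
    ultimately show ?thesis
      by simp
  qed
  have "(a * d - b * c) * (a * (- d) - b * c) = b\<^sup>2 * c\<^sup>2 - a\<^sup>2 * d\<^sup>2"
    by (simp add: power2_eq_square algebra_simps)
  also have "\<dots> = (q - a\<^sup>2) * c\<^sup>2 - a\<^sup>2 * (q - c\<^sup>2)"
    using ab cd by simp
  also have "\<dots> = q * (c\<^sup>2 - a\<^sup>2)"
    by (simp add: algebra_simps)
  finally have "q dvd (a * d - b * c) * (a * (- d) - b * c)"
    by simp
  hence "q dvd a * d - b * c \<or> q dvd a * (- d) - b * c"
    using \<open>prime q\<close> prime_dvd_mult_iff by blast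
  thus ?thesis
    using key[of d] key[of "- d"] by auto
qed

section \<open>Reduction to a Delannoy number\<close>

locale odd_prime =
  fixes p n :: nat
  assumes prime: "prime p" and p_eq: "p = 2 * n + 1"
begin

lemma n_pos: "0 < n"
  using prime_gt_1_nat[OF prime] p_eq by simp

lemma int_p_eq: "int p = 2 * int n + 1"
  by (simp add: p_eq)

lemma odd_p: "odd p"
  by (simp add: p_eq)

lemma coprime_int_p:
  assumes "0 < k" "k < p"
  shows "coprime (int k) (int p)"
proof -
  have "coprime p k"
    using assms by (intro prime_imp_coprime[OF prime]) (auto dest: dvd_imp_le)
  thus ?thesis
    by (simp add: coprime_commute)
qed

lemma cong_cancel_p2:
  fixes a b c :: int
  assumes "[c * a = c * b] (mod (int p)\<^sup>2)" "coprime c (int p)"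
  shows "[a = b] (mod (int p)\<^sup>2)"
  using assms by (simp add: cong_mult_lcancel)

lemma cong_p_if_p2: "[a = b] (mod (int p)\<^sup>2) \<Longrightarrow> [a = b] (mod int p)" for a b :: int
  by (erule cong_dvd_modulus) (simp add: power2_eq_square)

text \<open>In this range \<open>p\<close> divides (2k)! but not k!.\<close>

lemma p_dvd_central_binomial:
  assumes "n < k" "k \<le> 2 * n"
  shows "p dvd ((2 * k) choose k)"
proof -
  have "fact k * fact k * ((2 * k) choose k) = (fact (2 * k) :: nat)"
    using binomial_fact_lemma[of k "2 * k"] by simp
  moreover have "p dvd fact (2 * k)" "\<not> p dvd fact k"
    using assms p_eq prime by (auto simp: prime_dvd_fact_iff)
  ultimately show ?thesis
    using prime by (metis prime_dvd_mult_iff)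
qed

text \<open>Induction comparing the ratios of consecutive terms on both sides. The denominator
  (k+1)^2 is a unit because k + 1 < p.\<close>

lemma central_binomial_square_cong:
  assumes "k \<le> n"
  shows "[(int ((2 * k) choose k))\<^sup>2 =
          (-16) ^ k * int ((n choose k) * ((n + k) choose k))] (mod (int p)\<^sup>2)"
  using assms
proof (induction k)
  case (Suc k)
  define X where "X k = int ((2 * k) choose k)" for k
  define Y where "Y k = int (n choose k) * int ((n + k) choose k)" for k
  have X: "int (Suc k) * X (Suc k) = 2 * (2 * int k + 1) * X k"
    using Suc_times_central_binomial[of k, THEN arg_cong[of _ _ int]]
    unfolding X_def of_nat_mult by simp
  have a: "int (Suc k) * int (n choose Suc k) = (int n - int k) * int (n choose k)"
    by (rule Suc_times_binomial_int)
  have b: "int (Suc k) * int ((n + Suc k) choose Suc k) =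
           (int n + int k + 1) * int ((n + k) choose k)"
    using Suc_times_binomial[of k "n + k", THEN arg_cong[of _ _ int]]
    unfolding of_nat_mult by simp
  \<comment> \<open>Completing the square is what gives modulus \<open>p\<^sup>2\<close>: the two
    ratios differ only through the term \<open>p\<^sup>2\<close>.\<close>
  have "4 * ((int n - int k) * (int n + int k + 1)) = (int p)\<^sup>2 - (2 * int k + 1)\<^sup>2"
    unfolding int_p_eq by (simp add: power2_eq_square algebra_simps)
  moreover have "(int (Suc k))\<^sup>2 * Y (Suc k) = (int n - int k) * (int n + int k + 1) * Y k"
    using arg_cong2[OF a b, of "(*)"] unfolding Y_def by (simp only: power2_eq_square mult_ac)
  ultimately have Y: "4 * ((int (Suc k))\<^sup>2 * Y (Suc k)) = ((int p)\<^sup>2 - (2 * int k + 1)\<^sup>2) * Y k"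
    by (simp only: flip: mult.assoc)
  have "(int (Suc k))\<^sup>2 * (X (Suc k))\<^sup>2 = 4 * (2 * int k + 1)\<^sup>2 * (X k)\<^sup>2"
    using arg_cong[OF X, of "\<lambda>x. x\<^sup>2"] by (simp only: power_mult_distrib) simp
  also have "[\<dots> = 4 * (2 * int k + 1)\<^sup>2 * ((-16) ^ k * Y k)] (mod (int p)\<^sup>2)"
    using Suc unfolding X_def Y_def of_nat_mult by (intro cong_mult cong_refl) auto
  also have "[4 * (2 * int k + 1)\<^sup>2 * ((-16) ^ k * Y k) =
      (int (Suc k))\<^sup>2 * ((-16) ^ Suc k * Y (Suc k))] (mod (int p)\<^sup>2)"
  proof -
    have *: "4 * t * (z * y) - (-4) * z * ((q - t) * y) = q * (4 * z * y)" for q t z y :: int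
      by (simp add: algebra_simps)
    have "(int (Suc k))\<^sup>2 * ((-16) ^ Suc k * Y (Suc k)) =
          (-4) * (-16) ^ k * (4 * ((int (Suc k))\<^sup>2 * Y (Suc k)))"
      by simp
    also have "\<dots> = (-4) * (-16) ^ k * (((int p)\<^sup>2 - (2 * int k + 1)\<^sup>2) * Y k)"
      by (simp only: Y)
    finally show ?thesis
      unfolding cong_iff_dvd_diff by (intro dvdI[of _ _ "4 * (-16) ^ k * Y k"]) (simp only: *)
  qed
  finally have "[(int (Suc k))\<^sup>2 * (X (Suc k))\<^sup>2 =
      (int (Suc k))\<^sup>2 * ((-16) ^ Suc k * Y (Suc k))] (mod (int p)\<^sup>2)" .
  moreover have "coprime ((int (Suc k))\<^sup>2) (int p)"
    using coprime_int_p[of "Suc k"] Suc.prems p_eq by simp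
  ultimately show ?case
    unfolding X_def Y_def of_nat_mult by (rule cong_cancel_p2)
qed simp

text \<open>The factor n + k + 1 is congruent to -(n - k) because p = 2n + 1, so both sides satisfy
  the same recursion modulo \<open>p\<close>.\<close>

lemma binomial_reflection_cong:
  assumes "k \<le> n"
  shows "[int ((n + k) choose k) = (-1) ^ k * int (n choose k)] (mod int p)"
  using assms
proof (induction k)
  case (Suc k)
  have a: "int (Suc k) * int (n choose Suc k) = (int n - int k) * int (n choose k)"
    by (rule Suc_times_binomial_int)
  have b: "int (Suc k) * int ((n + Suc k) choose Suc k) =
           (int n + int k + 1) * int ((n + k) choose k)"
    using Suc_times_binomial[of k "n + k", THEN arg_cong[of _ _ int]]
    unfolding of_nat_mult by simp
  have "[(int n + int k + 1) * int ((n + k) choose k) =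
         (- (int n - int k)) * ((-1) ^ k * int (n choose k))] (mod int p)"
    using Suc by (intro cong_mult) (auto simp: cong_iff_dvd_diff int_p_eq)
  also have "(- (int n - int k)) * ((-1) ^ k * int (n choose k)) =
      int (Suc k) * ((-1) ^ Suc k * int (n choose Suc k))"
    using arg_cong[OF a, of "(*) ((-1) ^ Suc k)"]
    by (simp only: power_Suc mult_minus_left mult_1_left mult_minus_right mult.left_commute)
  finally have "[int (Suc k) * int ((n + Suc k) choose Suc k) =
      int (Suc k) * ((-1) ^ Suc k * int (n choose Suc k))] (mod int p)"
    unfolding b .
  moreover have "coprime (int (Suc k)) (int p)"
    using coprime_int_p[of "Suc k"] Suc.prems p_eq by simp
  ultimately show ?case
    by (simp only: cong_mult_lcancel)
qed simp

text \<open>The \<open>n\<close>-th central Delannoy number, which is the value at 3 of the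
  \<open>n\<close>-th Legendre polynomial.\<close>

definition delannoy :: int where
  "delannoy = (\<Sum>k\<le>n. int ((n choose k) * ((n + k) choose k)))"

lemma delannoy_eq: "delannoy = (\<Sum>k\<le>n. (int (n choose k))\<^sup>2 * 2 ^ k)"
  using sum_binomial_square_power_two[of n, THEN arg_cong[of _ _ int]]
  by (simp add: delannoy_def)

text \<open>The numerator of \<open>V_sum p m\<close> over the common denominator
  \<open>m ^ (2 * n)\<close>, which keeps the argument in the integers.\<close>

definition V_num :: "int \<Rightarrow> int" where
  "V_num m = (\<Sum>i\<le>2 * n. int (V i) * m ^ (2 * n - i))"

lemma V_sum_eq:
  assumes "m \<noteq> 0"
  shows "V_sum p m = of_int (V_num m) / of_int (m ^ (2 * n))"
proof -
  have "V_sum p m = (\<Sum>i\<le>2 * n. of_nat (V i) / of_int m ^ i)"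
    by (simp add: V_sum_def p_eq atLeast0AtMost)
  also have "\<dots> = (\<Sum>i\<le>2 * n. of_nat (V i) * of_int m ^ (2 * n - i) / of_int (m ^ (2 * n)))"
    using assms by (intro sum.cong refl) (simp add: power_diff field_simps)
  finally show ?thesis
    by (simp add: V_num_def sum_divide_distrib)
qed

text \<open>\<open>V\<close> is the self-convolution of the squared central binomial coefficients.
  Being squares, the terms beyond \<open>n\<close> are divisible even by
  \<open>p\<^sup>2\<close>.\<close>

lemma V_num_cong:
  "[V_num m = (\<Sum>k\<le>n. (int ((2 * k) choose k))\<^sup>2 * m ^ (n - k))\<^sup>2] (mod (int p)\<^sup>2)"
proof -
  have "V_num m = (\<Sum>i\<le>2 * n. (\<Sum>k\<le>i. (int ((2 * k) choose k))\<^sup>2 *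
      (int ((2 * (i - k)) choose (i - k)))\<^sup>2) * m ^ (2 * n - i))"
    by (simp add: V_num_def V_def diff_mult_distrib2)
  moreover have "(int p)\<^sup>2 dvd (int ((2 * k) choose k))\<^sup>2" if "n < k" "k \<le> 2 * n" for k
    using p_dvd_central_binomial[OF that] by (intro dvd_power_same) simp
  ultimately show ?thesis
    using truncated_square_cong[of n "(int p)\<^sup>2" "\<lambda>k. (int ((2 * k) choose k))\<^sup>2" m] by simp
qed

text \<open>For this base the factor (-16)^k of the congruence modulo \<open>p\<^sup>2\<close>
  cancels exactly, so no precision is lost.\<close>

lemma V_num_minus_16: "[V_num (-16) = (-16) ^ (2 * n) * delannoy\<^sup>2] (mod (int p)\<^sup>2)"
proof -
  have "[(\<Sum>k\<le>n. (int ((2 * k) choose k))\<^sup>2 * (-16) ^ (n - k)) = (\<Sum>k\<le>n.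
     (-16) ^ k * int ((n choose k) * ((n + k) choose k)) * (-16) ^ (n - k))] (mod (int p)\<^sup>2)"
    by (intro cong_sum cong_mult cong_refl central_binomial_square_cong) auto
  also have "(\<Sum>k\<le>n. (-16) ^ k * int ((n choose k) * ((n + k) choose k)) * (-16) ^ (n - k)) =
      (-16) ^ n * delannoy"
    unfolding delannoy_def sum_distrib_left
  proof (intro sum.cong refl)
    fix k assume "k \<in> {..n}"
    hence "(-16 :: int) ^ n = (-16) ^ k * (-16) ^ (n - k)"
      by (simp flip: power_add)
    thus "(-16) ^ k * int ((n choose k) * ((n + k) choose k)) * (-16) ^ (n - k) =
        (-16) ^ n * int ((n choose k) * ((n + k) choose k))"
      by simp
  qed
  finally have "[(\<Sum>k\<le>n. (int ((2 * k) choose k))\<^sup>2 * (-16) ^ (n - k))\<^sup>2 =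
      ((-16) ^ n * delannoy)\<^sup>2] (mod (int p)\<^sup>2)"
    by (rule cong_pow)
  thus ?thesis
    using cong_trans[OF V_num_cong] by (simp only: square_power_mult)
qed

text \<open>The reflection replaces C(n+k,k) by (-1)^k C(n,k) and absorbs the sign, at the price of
  lowering the modulus to \<open>p\<close>.\<close>

lemma central_binomial_square_cong':
  assumes "k \<le> n"
  shows "[(int ((2 * k) choose k))\<^sup>2 = 16 ^ k * (int (n choose k))\<^sup>2] (mod int p)"
proof -
  have "[(int ((2 * k) choose k))\<^sup>2 = (-16) ^ k * (int (n choose k) * int ((n + k) choose k))] (mod int p)"
    using cong_p_if_p2[OF central_binomial_square_cong[OF assms]] by simp
  also have "[(-16) ^ k * (int (n choose k) * int ((n + k) choose k)) =
      (-16) ^ k * (int (n choose k) * ((-1) ^ k * int (n choose k)))] (mod int p)"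
    by (intro cong_mult cong_refl binomial_reflection_cong assms)
  also have "(-16) ^ k * (int (n choose k) * ((-1) ^ k * int (n choose k))) =
      16 ^ k * (int (n choose k))\<^sup>2"
    using power_mult_distrib[of "-16 :: int" "-1" k] by (simp add: power2_eq_square)
  finally show ?thesis .
qed

text \<open>The quotient 16/8 = 2 produces the weights \<open>2 ^ k\<close> of
  \<open>delannoy_eq\<close>.\<close>

lemma V_num_8: "[V_num 8 = 8 ^ (2 * n) * delannoy\<^sup>2] (mod int p)"
proof -
  have "[(\<Sum>k\<le>n. (int ((2 * k) choose k))\<^sup>2 * 8 ^ (n - k)) =
      (\<Sum>k\<le>n. 16 ^ k * (int (n choose k))\<^sup>2 * 8 ^ (n - k))] (mod int p)"
    by (intro cong_sum cong_mult cong_refl central_binomial_square_cong') auto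
  also have "(\<Sum>k\<le>n. 16 ^ k * (int (n choose k))\<^sup>2 * 8 ^ (n - k)) = 8 ^ n * delannoy"
    unfolding delannoy_eq sum_distrib_left
  proof (intro sum.cong refl)
    fix k assume "k \<in> {..n}"
    hence "(8 :: int) ^ n = 8 ^ k * 8 ^ (n - k)" 
      by (simp flip: power_add)
    moreover have "(16 :: int) ^ k = 8 ^ k * 2 ^ k"
      by (simp flip: power_mult_distrib)
    ultimately show "16 ^ k * (int (n choose k))\<^sup>2 * 8 ^ (n - k) =
        8 ^ n * ((int (n choose k))\<^sup>2 * 2 ^ k)"
      by simp
  qed
  finally have "[(\<Sum>k\<le>n. (int ((2 * k) choose k))\<^sup>2 * 8 ^ (n - k))\<^sup>2 =
      (8 ^ n * delannoy)\<^sup>2] (mod int p)"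
    by (rule cong_pow)
  thus ?thesis
    using cong_trans[OF cong_p_if_p2[OF V_num_cong]] by (simp only: square_power_mult)
qed

lemma two_power_cong: "[2 ^ (2 * n) = (1 :: int)] (mod int p)"
proof -
  have "[2 ^ (p - 1) = (1 :: nat)] (mod p)"
    using prime odd_p by (intro fermat_theorem) (use n_pos p_eq in \<open>auto dest: dvd_imp_le\<close>)
  thus ?thesis
    using cong_int_iff[of "2 ^ (p - 1)" 1 p] by (simp add: p_eq)
qed

text \<open>The quotient 16/32 = 1/2 gives the weights of \<open>delannoy_eq\<close> in reverse
  order, so the sum is reversed.\<close>

lemma V_num_32: "[V_num 32 = 32 ^ (2 * n) * delannoy\<^sup>2] (mod int p)"
proof -
  have "[(\<Sum>k\<le>n. (int ((2 * k) choose k))\<^sup>2 * 32 ^ (n - k)) =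
      (\<Sum>k\<le>n. 16 ^ k * (int (n choose k))\<^sup>2 * 32 ^ (n - k))] (mod int p)"
    by (intro cong_sum cong_mult cong_refl central_binomial_square_cong') auto
  also have "(\<Sum>k\<le>n. 16 ^ k * (int (n choose k))\<^sup>2 * 32 ^ (n - k)) =
      (\<Sum>k\<le>n. 16 ^ n * ((int (n choose (n - k)))\<^sup>2 * 2 ^ (n - k)))"
  proof (intro sum.cong refl)
    fix k assume "k \<in> {..n}"
    hence "(16 :: int) ^ n = 16 ^ k * 16 ^ (n - k)"
      by (simp flip: power_add)
    moreover have "n choose k = n choose (n - k)"
      using \<open>k \<in> {..n}\<close> by (intro binomial_symmetric) simp
    moreover have "(32 :: int) ^ (n - k) = 16 ^ (n - k) * 2 ^ (n - k)"
      by (simp flip: power_mult_distrib)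
    ultimately show "16 ^ k * (int (n choose k))\<^sup>2 * 32 ^ (n - k) =
        16 ^ n * ((int (n choose (n - k)))\<^sup>2 * 2 ^ (n - k))"
      by (simp only: mult_ac)
  qed
  also have "\<dots> = 16 ^ n * delannoy"
    unfolding delannoy_eq sum_distrib_left[symmetric]
    by (rule arg_cong[of _ _ "(*) _"], rule sum_atMost_rev[symmetric])
  finally have "[(\<Sum>k\<le>n. (int ((2 * k) choose k))\<^sup>2 * 32 ^ (n - k))\<^sup>2 =
      (16 ^ n * delannoy)\<^sup>2] (mod int p)"
    by (rule cong_pow)
  also have "(16 ^ n * delannoy)\<^sup>2 = 16 ^ (2 * n) * delannoy\<^sup>2 * 1"
    by (simp only: square_power_mult mult_1_right)
  \<comment> \<open>The reversal left powers of 16 in place of powers of 32; Fermat supplies the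
    missing power of 2.\<close>
  also have "[16 ^ (2 * n) * delannoy\<^sup>2 * 1 = 16 ^ (2 * n) * delannoy\<^sup>2 * 2 ^ (2 * n)] (mod int p)"
    by (intro cong_mult cong_refl cong_sym[OF two_power_cong])
  also have "16 ^ (2 * n) * delannoy\<^sup>2 * 2 ^ (2 * n) = (16 * 2) ^ (2 * n) * delannoy\<^sup>2"
    by (simp only: power_mult_distrib mult_ac)
  finally show ?thesis
    using cong_trans[OF cong_p_if_p2[OF V_num_cong]] by simp
qed

end

section \<open>Binomial coefficients modulo the square of a prime\<close>

context odd_prime
begin

text \<open>Reflection turns the sum into that of (-1)^k C(n,k)^2, whose terms change sign under k
  -> n - k for odd \<open>n\<close>.\<close>

lemma delannoy_cong_0:
  assumes "odd n"
  shows "[delannoy = 0] (mod int p)"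
proof -
  define S where "S = (\<Sum>k\<le>n. (-1) ^ k * (int (n choose k))\<^sup>2)"
  have "S = (\<Sum>k\<le>n. (-1) ^ (n - k) * (int (n choose (n - k)))\<^sup>2)"
    unfolding S_def by (rule sum_atMost_rev)
  also have "\<dots> = (\<Sum>k\<le>n. - ((-1) ^ k * (int (n choose k))\<^sup>2))"
  proof (intro sum.cong refl)
    fix k assume k: "k \<in> {..n}"
    hence "(-1) ^ (n - k) = - ((-1) ^ k :: int)"
      using assms by (auto simp: minus_one_power_iff)
    thus "(-1) ^ (n - k) * (int (n choose (n - k)))\<^sup>2 = - ((-1) ^ k * (int (n choose k))\<^sup>2)"
      using binomial_symmetric[of k n] k by simp
  qed
  finally have "S = 0"
    unfolding S_def by (simp add: sum_negf)
  have "[delannoy = (\<Sum>k\<le>n. int (n choose k) * ((-1) ^ k * int (n choose k)))] (mod int p)"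
    unfolding delannoy_def of_nat_mult
    by (intro cong_sum cong_mult cong_refl binomial_reflection_cong) simp
  also have "(\<Sum>k\<le>n. int (n choose k) * ((-1) ^ k * int (n choose k))) = S"
    by (simp add: S_def power2_eq_square mult_ac)
  finally show ?thesis
    by (simp add: \<open>S = 0\<close>)
qed

text \<open>Wilson's theorem is the case k = 0. Each step moves a factor from one factorial to the
  other, and k + 1 is congruent to -(p - 1 - k).\<close>

lemma fact_complement_cong:
  assumes "k < p"
  shows "[fact k * fact (p - 1 - k) = (-1) ^ Suc k] (mod int p)"
  using assms
proof (induction k)
  case 0
  show ?case
    using wilson_theorem[OF prime] by simp
next
  case (Suc k)
  define m where "m = p - 1 - Suc k"
  have m: "p - 1 - k = Suc m" and p: "int p = int m + int k + 2"
    using Suc.prems by (auto simp: m_def)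
  have "fact (Suc k) * fact m = - (fact k * fact (Suc m)) + int p * (fact k * fact m)"
    unfolding p by (simp add: algebra_simps)
  also have "[\<dots> = - ((-1) ^ Suc k) + 0] (mod int p)"
    using Suc m by (intro cong_add cong_uminus) (auto simp: cong_0_iff)
  finally show ?case
    by (simp add: m_def)
qed

text \<open>By Wilson, p! is congruent to -p modulo \<open>p\<^sup>2\<close>. As a factor
  \<open>p\<close> is then present, each further factor p + j may be replaced by j.\<close>

lemma fact_add_p_cong: "[fact (p + k) = - int p * fact k] (mod (int p)\<^sup>2)"
proof (induction k)
  case 0
  have "fact p = int p * fact (p - 1)"
    using n_pos p_eq by (simp add: fact_reduce)
  also have "[\<dots> = int p * (-1)] (mod int p * int p)"
    using wilson_theorem[OF prime] by (rule cong_cmult_leftI)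
  finally show ?case
    by (simp add: power2_eq_square)
next
  case (Suc k)
  have "[(int p + int (Suc k)) * fact (p + k) = (int p + int (Suc k)) * (- int p * fact k)] (mod (int p)\<^sup>2)"
    using Suc by (intro cong_mult cong_refl)
  also have "[(int p + int (Suc k)) * (- int p * fact k) = - int p * fact (Suc k)] (mod (int p)\<^sup>2)"
    unfolding cong_iff_dvd_diff
    by (intro dvdI[of _ _ "- fact k"]) (simp add: algebra_simps power2_eq_square)
  finally show ?case
    by (simp add: algebra_simps)
qed

end

section \<open>Binomial coefficients for primes p = 4h + 1\<close>

locale prime_1_mod_4 = odd_prime p n for p n :: nat +
  fixes h :: nat
  assumes n_eq: "n = 2 * h"
begin

lemma p_eq_h: "int p = 4 * int h + 1"
  by (simp add: int_p_eq n_eq)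

lemma h_pos: "0 < h"
  using n_pos n_eq by simp

text \<open>
  With \<open>a\<^sub>k = C(n,k)\<close> and \<open>b\<^sub>k = (-1)^k C(n+k,k)\<close>, each product \<open>(a\<^sub>k - b\<^sub>k) (a\<^sub>n\<^sub>-\<^sub>k - b\<^sub>n\<^sub>-\<^sub>k)\<close>
  vanishes modulo \<open>p\<^sup>2\<close>; in the alternating sum the mixed terms are \<open>D\<close> and the others have closed forms.
\<close>

lemma twice_delannoy_cong:
  "[2 * delannoy = (-1) ^ h * int ((2 * h) choose h) + int ((3 * h) choose h)] (mod (int p)\<^sup>2)"
proof -
  define a where "a k = int (n choose k)" for k
  define b where "b k = (-1) ^ k * int ((n + k) choose k)" for k
  have a_sym: "a (n - k) = a k" if "k \<le> n" for k
    using binomial_symmetric[OF that] by (simp add: a_def)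
  have "int p dvd a k - b k" if "k \<le> n" for k
  proof -
    have "[b k = (-1) ^ k * ((-1) ^ k * a k)] (mod int p)"
      unfolding a_def b_def using that by (intro cong_mult cong_refl binomial_reflection_cong)
    thus ?thesis
      by (simp add: cong_iff_dvd_diff dvd_diff_commute flip: mult.assoc power_mult_distrib)
  qed
  hence "int p * int p dvd (a k - b k) * (a (n - k) - b (n - k))" if "k \<le> n" for k
    using that by (intro mult_dvd_mono) auto
  hence "(int p)\<^sup>2 dvd (\<Sum>k\<le>n. (-1) ^ k * ((a k - b k) * (a (n - k) - b (n - k))))"
    unfolding power2_eq_square by (intro dvd_sum) (simp only: atMost_iff dvd_mult)
  also have "(\<Sum>k\<le>n. (-1) ^ k * ((a k - b k) * (a (n - k) - b (n - k)))) =
      (\<Sum>k\<le>n. (-1) ^ k * a k * a (n - k)) + (\<Sum>k\<le>n. (-1) ^ k * b k * b (n - k)) -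
      ((\<Sum>k\<le>n. (-1) ^ k * a (n - k) * b k) + (\<Sum>k\<le>n. (-1) ^ k * a k * b (n - k)))"
    by (simp add: algebra_simps sum.distrib sum_subtractf)
  also have "(\<Sum>k\<le>n. (-1) ^ k * a k * a (n - k)) = (-1) ^ h * int ((2 * h) choose h)"
    unfolding a_def using binomial_alternating_convolution[where N = n and h = h] by (simp only: n_eq)
  also have "(\<Sum>k\<le>n. (-1) ^ k * b k * b (n - k)) =
      (\<Sum>k\<le>n. (-1) ^ k * int ((n + k) choose k) * int ((n + (n - k)) choose (n - k)))"
  proof (intro sum.cong refl)
    fix k assume "k \<in> {..n}"
    hence "even (k + (n - k))"
      by (simp add: n_eq)
    thus "(-1) ^ k * b k * b (n - k) =
        (-1) ^ k * int ((n + k) choose k) * int ((n + (n - k)) choose (n - k))"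
      by (auto simp: b_def minus_one_power_iff)
  qed
  also have "\<dots> = int ((n + h) choose h)"
    using multiset_binomial_alternating_convolution[where N = n and h = h] by (simp only: n_eq)
  \<comment> \<open>Reversing the summation identifies the two mixed sums; the signs agree because
    \<open>n\<close> is even.\<close>
  also have "(\<Sum>k\<le>n. (-1) ^ k * a k * b (n - k)) = (\<Sum>k\<le>n. (-1) ^ (n - k) * a (n - k) * b (n - (n - k)))"
    by (rule sum_atMost_rev)
  also have "\<dots> = (\<Sum>k\<le>n. (-1) ^ k * a (n - k) * b k)"
    by (intro sum.cong refl) (auto simp: minus_one_power_iff n_eq)
  also have "(\<Sum>k\<le>n. (-1) ^ k * a (n - k) * b k) = delannoy"
    unfolding delannoy_def by (intro sum.cong refl) (simp add: a_sym, simp add: a_def b_def)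
  finally show ?thesis
    by (simp add: cong_iff_dvd_diff dvd_diff_commute n_eq mult.commute)
qed

text \<open>
  Up to the factor \<open>2^h h!\<close>, the three binomial coefficients come from the values at \<open>p\<close>, \<open>-p\<close> and
  \<open>3p\<close> of the polynomial \<open>\<Prod>j<h. X - (2j + 1)\<close>, which is linear modulo \<open>X\<^sup>2\<close>.
\<close>

lemma binomial_6h_h_cong:
  defines "A \<equiv> int ((2 * h) choose h)"
  shows "[2 * int ((6 * h) choose h) =
          2 * A - (-1) ^ h * int ((3 * h) choose h) - 2 * int p * A] (mod (int p)\<^sup>2)"
proof -
  define A' where "A' = (-1) ^ h * int ((3 * h) choose h)"
  define B where "B = int ((6 * h) choose h)"
  define K :: int where "K = 2 ^ h * fact h"
  define P where "P = int p"
  define F where "F y = (\<Prod>j<h. P * y - (2 * int j + 1))" for y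
  obtain a b where ab: "[F y = a + b * (P * y)] (mod P\<^sup>2)" for y
    unfolding F_def using prod_cong_linear[where r = "\<lambda>j. 2 * int j + 1"] by blast
  have F1: "F 1 = K * A"
    unfolding K_def A_def prod_eq_fact_times_binomial[symmetric] F_def P_def p_eq_h
    by (intro prod.cong) auto
  have Fm: "F (-1) = K * A'"
  proof -
    have "F (-1) = (\<Prod>j<h. (-1) * (2 * int (3 * h) - 2 * int (h - Suc j)))"
      unfolding F_def P_def p_eq_h by (intro prod.cong) (auto simp: of_nat_diff)
    also have "\<dots> = (-1) ^ h * (\<Prod>j<h. 2 * int (3 * h) - 2 * int (h - Suc j))"
      by (simp only: prod.distrib) simp
    also have "(\<Prod>j<h. 2 * int (3 * h) - 2 * int (h - Suc j)) = (\<Prod>j<h. 2 * int (3 * h) - 2 * int j)"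
      by (rule prod.nat_diff_reindex)
    finally show ?thesis
      by (simp only: prod_eq_fact_times_binomial) (simp add: K_def A'_def)
  qed
  \<comment> \<open>\<open>K * B\<close> has the factors 3P - (2j+1) for j from 1 to h, one place
    off from \<open>F 3\<close>. Multiplying by 3P - 1 supplies j = 0 and leaves an extra last
    factor, whose double is 5P - 1 since 4h = P - 1.\<close>
  have "(3 * P - 1) * (K * B) = (3 * P - 1) * (\<Prod>j<h. 2 * int (6 * h) - 2 * int j)"
    by (simp only: K_def B_def prod_eq_fact_times_binomial)
  also have "(\<Prod>j<h. 2 * int (6 * h) - 2 * int j) = (\<Prod>j<h. P * 3 - (2 * int (Suc j) + 1))"
    unfolding P_def p_eq_h by (intro prod.cong) auto
  also have "(3 * P - 1) * \<dots> = (\<Prod>j<Suc h. P * 3 - (2 * int j + 1))"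
    by (subst prod.lessThan_Suc_shift) simp
  also have "\<dots> = F 3 * (3 * P - (2 * int h + 1))"
    by (simp add: F_def mult.commute)
  finally have B: "2 * ((3 * P - 1) * (K * B)) = F 3 * (5 * P - 1)"
    by (simp add: P_def p_eq_h)
  have "(3 * P - 1) * K * (2 * B) = F 3 * (5 * P - 1)"
    using B by (simp only: mult_ac)
  also have "[F 3 * (5 * P - 1) = (a + 3 * b * P) * (5 * P - 1)] (mod P\<^sup>2)"
    using ab[of 3] by (intro cong_mult cong_refl) (simp add: mult_ac)
  also have "[(a + 3 * b * P) * (5 * P - 1) =
      (3 * P - 1) * (2 * (a + b * P) - (a - b * P) - 2 * P * (a + b * P))] (mod P\<^sup>2)"
    unfolding cong_iff_dvd_diff
    by (intro dvdI[of _ _ "4 * b + 6 * a + 6 * b * P"]) (simp add: algebra_simps power2_eq_square)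
  also have "[(3 * P - 1) * (2 * (a + b * P) - (a - b * P) - 2 * P * (a + b * P)) =
      (3 * P - 1) * (2 * (K * A) - K * A' - 2 * P * (K * A))] (mod P\<^sup>2)"
    using cong_sym[OF ab[of 1]] cong_sym[OF ab[of "-1"]] unfolding F1 Fm
    by (intro cong_mult cong_diff cong_refl) simp_all
  also have "(3 * P - 1) * (2 * (K * A) - K * A' - 2 * P * (K * A)) =
      (3 * P - 1) * K * (2 * A - A' - 2 * P * A)"
    by (simp add: algebra_simps)
  finally have "[(3 * P - 1) * K * (2 * B) = (3 * P - 1) * K * (2 * A - A' - 2 * P * A)] (mod P\<^sup>2)" .
  moreover have "coprime ((3 * P - 1) * K) (int p)"
  proof -
    have "coprime (fact h) (int p)"
    proof -
      have "coprime p (fact h)"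
        using prime n_eq p_eq by (intro prime_imp_coprime) (auto simp: prime_dvd_fact_iff)
      thus ?thesis
        by (metis coprime_commute coprime_int_iff of_nat_fact)
    qed
    moreover have "coprime (3 * P - 1) (int p)"
      unfolding P_def using coprime_diff_one_left[of "3 * int p"] by simp
    moreover have "coprime (2 :: int) (int p)"
      using odd_p by simp
    ultimately show ?thesis
      by (simp add: K_def)
  qed
  ultimately show ?thesis
    unfolding P_def A'_def B_def by (rule cong_cancel_p2)
qed

lemma binomial_2h_h_cong: "[int ((2 * h) choose h) = (-1) ^ h * int ((3 * h) choose h)] (mod int p)"
proof -
  have "[(-1) ^ h * int ((3 * h) choose h) = (-1) ^ h * ((-1) ^ h * int ((2 * h) choose h))] (mod int p)"
    using binomial_reflection_cong[of h] by (intro cong_mult cong_refl) (simp add: n_eq)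
  thus ?thesis
    by (simp add: cong_sym flip: mult.assoc power_mult_distrib)
qed

text \<open>The cofactor \<open>g\<close> is found modulo \<open>p\<close> from factorials: 6h = p +
  (2h - 1) gives (6h)!, while h! (3h)! and (2h)! (2h)! are complementary products, known by
  Wilson.\<close>

lemma binomial_6h_3h:
  obtains g where "int ((6 * h) choose (3 * h)) = int p * g"
    and "[int ((2 * h) choose h) * g = -2] (mod int p)"
proof -
  define A where "A = int ((2 * h) choose h)"
  define G where "G = int ((6 * h) choose (3 * h))"
  have A: "(fact h)\<^sup>2 * A = fact (2 * h)"
    using binomial_fact_lemma[of h "2 * h", THEN arg_cong[of _ _ int]]
    by (simp add: A_def power2_eq_square)
  have G: "(fact (3 * h))\<^sup>2 * G = fact (6 * h)"
    using binomial_fact_lemma[of "3 * h" "6 * h", THEN arg_cong[of _ _ int]]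
    by (simp add: G_def power2_eq_square)
  have "p dvd ((6 * h) choose (3 * h))"
    using p_dvd_central_binomial[of "3 * h"] by (simp add: n_eq h_pos)
  then obtain g where g: "G = int p * g"
    unfolding G_def by (metis dvd_def of_nat_dvd_iff)
  have "[2 * int h * fact (p + (2 * h - 1)) = 2 * int h * (- int p * fact (2 * h - 1))] (mod (int p)\<^sup>2)"
    by (intro cong_mult cong_refl fact_add_p_cong)
  also have "2 * int h * (- int p * fact (2 * h - 1)) = - int p * fact (2 * h)"
    using h_pos by (simp add: fact_reduce[of "2 * h"])
  also have "p + (2 * h - 1) = 6 * h"
    using h_pos p_eq n_eq by simp
  also have "2 * int h * fact (6 * h) = int p * (2 * int h * (fact (3 * h))\<^sup>2 * g)"
    unfolding G[symmetric] g by (simp only: mult_ac)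
  finally have "[int p * (2 * int h * (fact (3 * h))\<^sup>2 * g) = int p * (- fact (2 * h))] (mod int p * int p)"
    by (simp add: power2_eq_square)
  hence "[2 * int h * (fact (3 * h))\<^sup>2 * g = - fact (2 * h)] (mod int p)"
    using prime_gt_0_nat[OF prime]
    by (simp only: cong_iff_dvd_diff right_diff_distrib[symmetric] dvd_mult_cancel_left) simp
  \<comment> \<open>Multiplying by \<open>(fact h)\<^sup>2 * A\<close>, which equals (2h)!, creates
    the complementary products on both sides.\<close>
  hence "[(fact h)\<^sup>2 * A * (2 * int h * (fact (3 * h))\<^sup>2 * g) =
      fact (2 * h) * (- fact (2 * h))] (mod int p)"
    unfolding A by (intro cong_mult cong_refl)
  also have "(fact h)\<^sup>2 * A * (2 * int h * (fact (3 * h))\<^sup>2 * g) =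
      (fact h * fact (3 * h))\<^sup>2 * (2 * int h * A * g)"
    by (simp only: power_mult_distrib mult_ac)
  finally have "[(fact h * fact (3 * h))\<^sup>2 * (2 * int h * A * g) = - (fact (2 * h) * fact (2 * h))] (mod int p)"
    by simp
  moreover have "[fact h * fact (3 * h) = (-1) ^ Suc h] (mod int p)"
    using fact_complement_cong[of h] p_eq n_eq by simp
  hence "[(fact h * fact (3 * h))\<^sup>2 * (2 * int h * A * g) = ((-1) ^ Suc h)\<^sup>2 * (2 * int h * A * g)] (mod int p)"
    by (intro cong_mult cong_pow cong_refl)
  moreover have "[- (fact (2 * h) * fact (2 * h)) = - ((-1) ^ Suc (2 * h))] (mod int p)"
    using fact_complement_cong[of "2 * h"] p_eq n_eq by (intro cong_uminus) simp
  ultimately have "[2 * int h * A * g = 1] (mod int p)"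
    by (simp add: cong_def flip: power_even_eq)
  \<comment> \<open>The inverse of 2h modulo \<open>p\<close> is -2, because p - 4h = 1.\<close>
  hence "[int p * (A * g) + (-2) * (2 * int h * A * g) = 0 + (-2) * 1] (mod int p)"
    by (intro cong_add cong_mult) (auto simp: cong_0_iff)
  hence "[A * g = -2] (mod int p)"
    by (simp add: p_eq_h algebra_simps)
  thus ?thesis
    using that g unfolding A_def G_def by blast
qed

end

section \<open>Jacobsthal sums\<close>

context odd_prime
begin

section \<open>The quadratic character modulo p and sums over residues\<close>

lemma p_gt_2: "2 < p"
  using n_pos p_eq by simp

lemma prime_int_p: "prime (int p)"
  using prime by simp

abbreviation chi :: "int \<Rightarrow> int" where
  "chi a \<equiv> Legendre a (int p)"

lemma chi_values: "chi a = -1 \<or> chi a = 0 \<or> chi a = 1"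
  by (auto simp: Legendre_def)

lemma chi_eq_0_iff: "chi a = 0 \<longleftrightarrow> int p dvd a"
  by (auto simp: Legendre_def cong_0_iff)

lemma chi_0: "chi 0 = 0"
  by (simp add: chi_eq_0_iff)

lemma chi_power_odd: "odd k \<Longrightarrow> chi a ^ k = chi a"
  using chi_values[of a] by (auto dest: odd_pos)

lemma chi_square: "\<not> int p dvd a \<Longrightarrow> (chi a)\<^sup>2 = 1"
  using chi_values[of a] chi_eq_0_iff[of a] by auto

lemma chi_euler: "[chi a = a ^ n] (mod int p)"
proof (cases "int p dvd a")
  case True
  thus ?thesis
    using chi_eq_0_iff[of a] dvd_trans[OF True dvd_power[of n a]] n_pos
    by (simp add: cong_0_iff cong_sym_eq[of 0])
next
  case False
  thus ?thesis
    using euler_criterion[OF prime p_gt_2, of a] by (simp add: p_eq)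
qed

text \<open>Two such values differ by at most 2 < p. This turns congruences between characters into
  equalities.\<close>

lemma sign_cong_imp_eq:
  fixes x y :: int
  assumes "x = -1 \<or> x = 0 \<or> x = 1" "y = -1 \<or> y = 0 \<or> y = 1" "[x = y] (mod int p)"
  shows "x = y"
proof (rule ccontr)
  assume "x \<noteq> y"
  hence "int p \<le> \<bar>x - y\<bar>"
    using assms(3) by (intro zdvd_imp_le) (auto simp: cong_iff_dvd_diff)
  thus False
    using assms(1,2) p_gt_2 by auto
qed

lemma chi_mult: "chi (a * b) = chi a * chi b"
proof (rule sign_cong_imp_eq)
  have "[chi (a * b) = a ^ n * b ^ n] (mod int p)"
    using chi_euler[of "a * b"] by (simp add: power_mult_distrib)
  also have "[a ^ n * b ^ n = chi a * chi b] (mod int p)"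
    by (intro cong_mult cong_sym[OF chi_euler])
  finally show "[chi (a * b) = chi a * chi b] (mod int p)" .
qed (use chi_values[of a] chi_values[of b] chi_values[of "a * b"] in auto)

lemma chi_cong:
  assumes "[a = b] (mod int p)"
  shows "chi a = chi b"
proof (rule sign_cong_imp_eq)
  have "[chi a = a ^ n] (mod int p)" "[a ^ n = b ^ n] (mod int p)" "[b ^ n = chi b] (mod int p)"
    using chi_euler cong_pow[OF assms] cong_sym by blast+
  thus "[chi a = chi b] (mod int p)"
    by (metis cong_trans)
qed (use chi_values in auto)

lemma ex_generator: "\<exists>g :: int. \<not> int p dvd g \<and> (\<forall>j. [g ^ j = 1] (mod int p) \<longrightarrow> (p - 1) dvd j)"
proof -
  obtain g where g: "residue_primroot p g"
    using prime_primitive_root_exists[OF _ prime] prime_gt_1_nat[OF prime] by blast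
  have "\<not> int p dvd int g"
    using g prime by (auto simp: residue_primroot_def dest: coprime_absorb_left)
  moreover have "(p - 1) dvd j" if "[int g ^ j = 1] (mod int p)" for j
  proof -
    have "[g ^ j = 1] (mod p)"
      using that cong_int_iff[of "g ^ j" 1 p] by simp
    hence "ord p g dvd j"
      using ord_divides[of g j p] by simp
    thus ?thesis
      using g prime by (simp add: residue_primroot_def totient_prime)
  qed
  ultimately show ?thesis
    by blast
qed

lemma ex_nonresidue: "\<exists>g. chi g = -1"
proof -
  obtain g where g: "\<not> int p dvd g" "\<And>j. [g ^ j = 1] (mod int p) \<Longrightarrow> (p - 1) dvd j"
    using ex_generator by blast
  have "chi g \<noteq> 1"
  proof
    assume "chi g = 1"
    hence "(p - 1) dvd n"
      using chi_euler[of g] g(2)[of n] by (simp add: cong_sym_eq)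
    thus False
      using n_pos p_eq by (auto dest: dvd_imp_le)
  qed
  thus ?thesis
    using chi_values[of g] g(1) chi_eq_0_iff[of g] by blast
qed

text \<open>The map t -> ct + d permutes the residues; the hypothesis on \<open>F\<close> allows
  reducing its argument modulo \<open>p\<close>.\<close>

lemma sum_residues_affine:
  fixes F :: "int \<Rightarrow> 'a :: comm_monoid_add"
  assumes F: "\<And>a. F (a mod int p) = F a" and c: "\<not> int p dvd c"
  shows "(\<Sum>t\<in>{0..<int p}. F (c * t + d)) = (\<Sum>t\<in>{0..<int p}. F t)"
proof -
  define f where "f t = (c * t + d) mod int p" for t
  have "inj_on f {0..<int p}"
  proof (rule inj_onI)
    fix s t assume st: "s \<in> {0..<int p}" "t \<in> {0..<int p}" "f s = f t"
    hence "int p dvd c * (s - t)"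
      by (simp add: f_def mod_eq_dvd_iff right_diff_distrib)
    hence "int p dvd s - t"
      using c prime_int_p by (simp add: prime_dvd_mult_iff)
    hence "s mod int p = t mod int p"
      by (simp add: mod_eq_dvd_iff)
    thus "s = t"
      using st by simp
  qed
  moreover have "f ` {0..<int p} \<subseteq> {0..<int p}"
    using p_gt_2 by (auto simp: f_def)
  ultimately have "bij_betw f {0..<int p} {0..<int p}"
    by (simp add: bij_betw_def endo_inj_surj)
  hence "(\<Sum>t\<in>{0..<int p}. F (f t)) = (\<Sum>t\<in>{0..<int p}. F t)"
    by (rule sum.reindex_bij_betw)
  thus ?thesis
    by (simp add: f_def F)
qed

lemma sum_nonzero_residues:
  fixes F :: "int \<Rightarrow> 'a :: comm_monoid_add"
  assumes "F 0 = 0"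
  shows "(\<Sum>t\<in>{0..<int p}. F t) = (\<Sum>t\<in>{1..<int p}. F t)"
  using assms by (intro sum.mono_neutral_right) (auto simp: order.order_iff_strict)

lemma not_dvd_residue: "t \<in> {1..<int p} \<Longrightarrow> \<not> int p dvd t"
  by (auto dest: zdvd_imp_le)

text \<open>Scaling by a nonresidue permutes the terms and negates the sum.\<close>

lemma sum_chi: "(\<Sum>t\<in>{0..<int p}. chi t) = 0"
proof -
  obtain g where g: "chi g = -1"
    using ex_nonresidue by blast
  hence "\<not> int p dvd g"
    using chi_eq_0_iff[of g] by simp
  hence "(\<Sum>t\<in>{0..<int p}. chi (g * t + 0)) = (\<Sum>t\<in>{0..<int p}. chi t)"
    by (intro sum_residues_affine) (auto intro: chi_cong)
  thus ?thesis
    by (simp add: chi_mult g sum_negf)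
qed

section \<open>Autocorrelation of the quadratic character\<close>

definition correlation :: "int \<Rightarrow> int" where
  "correlation k = (\<Sum>t\<in>{0..<int p}. chi t * chi (t - k))"

lemma correlation_dvd:
  assumes "int p dvd k"
  shows "correlation k = int p - 1"
proof -
  have "chi (t - k) = chi t" for t
    using assms by (intro chi_cong) (simp add: cong_iff_dvd_diff)
  hence "correlation k = (\<Sum>t\<in>{0..<int p}. (chi t)\<^sup>2)"
    by (simp add: correlation_def power2_eq_square)
  also have "\<dots> = (\<Sum>t\<in>{1..<int p}. (chi t)\<^sup>2)"
    by (rule sum_nonzero_residues) (simp add: chi_0)
  also have "\<dots> = (\<Sum>t\<in>{1..<int p}. 1)"
    by (intro sum.cong refl chi_square not_dvd_residue)
  finally show ?thesis
    using p_gt_2 by simp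
qed

text \<open>The substitution t -> kt pulls out \<open>(chi k)\<^sup>2\<close>, which is 1.\<close>

lemma correlation_eq_1:
  assumes "\<not> int p dvd k"
  shows "correlation k = correlation 1"
proof -
  have "correlation k = (\<Sum>t\<in>{0..<int p}. chi (k * t + 0) * chi (k * t + 0 - k))"
    unfolding correlation_def using assms
    by (intro sum_residues_affine[symmetric, where F = "\<lambda>t. chi t * chi (t - k)"])
       (auto intro!: arg_cong2[of _ _ _ _ "(*)"] chi_cong simp: cong_diff)
  also have "\<dots> = (\<Sum>t\<in>{0..<int p}. (chi k)\<^sup>2 * (chi t * chi (t - 1)))"
  proof (intro sum.cong refl)
    fix t
    have "k * t + 0 - k = k * (t - 1)"
      by (simp add: algebra_simps)
    thus "chi (k * t + 0) * chi (k * t + 0 - k) = (chi k)\<^sup>2 * (chi t * chi (t - 1))"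
      by (simp add: chi_mult power2_eq_square)
  qed
  finally show ?thesis
    by (simp add: correlation_def chi_square[OF assms])
qed

lemma sum_chi_translate: "(\<Sum>k\<in>{0..<int p}. chi (t - k)) = 0"
proof -
  have "(\<Sum>k\<in>{0..<int p}. chi (-1 * k + t)) = (\<Sum>t\<in>{0..<int p}. chi t)"
    using p_gt_2 by (intro sum_residues_affine) (auto intro: chi_cong dest: zdvd_imp_le)
  thus ?thesis
    by (simp add: sum_chi)
qed

text \<open>The correlations over all shifts sum to 0. The shift 0 contributes p - 1, and the p - 1
  other shifts contribute equally.\<close>

lemma correlation_not_dvd:
  assumes "\<not> int p dvd k"
  shows "correlation k = -1"
proof -
  have "0 = (\<Sum>t\<in>{0..<int p}. chi t * (\<Sum>k\<in>{0..<int p}. chi (t - k)))"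
    by (simp add: sum_chi_translate)
  also have "\<dots> = (\<Sum>k\<in>{0..<int p}. correlation k)"
    unfolding correlation_def sum_distrib_left by (rule sum.swap)
  also have "{0..<int p} = insert 0 {1..<int p}"
    using p_gt_2 by auto
  also have "(\<Sum>k\<in>insert 0 {1..<int p}. correlation k) =
      correlation 0 + (\<Sum>k\<in>{1..<int p}. correlation k)"
    by (rule sum.insert) auto
  also have "(\<Sum>k\<in>{1..<int p}. correlation k) = (\<Sum>k\<in>{1..<int p}. correlation 1)"
    by (intro sum.cong refl correlation_eq_1 not_dvd_residue)
  also have "correlation 0 + \<dots> = (int p - 1) * (1 + correlation 1)"
    using p_gt_2 by (simp add: correlation_dvd algebra_simps)
  finally have "correlation 1 = -1"
    using p_gt_2 by simp
  thus ?thesis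
    using correlation_eq_1[OF assms] by simp
qed

lemma sum_chi_quadratic:
  "(\<Sum>a\<in>{0..<int p}. chi (u - a) * chi (v - a)) = (if int p dvd u - v then int p - 1 else -1)"
proof -
  have "(\<Sum>a\<in>{0..<int p}. chi (u - a) * chi (v - a)) =
      (\<Sum>a\<in>{0..<int p}. (\<lambda>t. chi t * chi (t - (u - v))) (-1 * a + u))"
    by (intro sum.cong) (auto simp: algebra_simps)
  also have "\<dots> = correlation (u - v)"
    unfolding correlation_def using p_gt_2
    by (intro sum_residues_affine)
       (auto intro!: arg_cong2[of _ _ _ _ "(*)"] chi_cong simp: cong_diff dest: zdvd_imp_le)
  finally show ?thesis
    by (simp add: correlation_dvd correlation_not_dvd)
qed

section \<open>Scaling of Jacobsthal sums\<close>

definition jacobsthal :: "int \<Rightarrow> int" where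
  "jacobsthal a = (\<Sum>t\<in>{0..<int p}. chi t * chi (t\<^sup>2 - a))"

lemma jacobsthal_cong:
  assumes "[a = b] (mod int p)"
  shows "jacobsthal a = jacobsthal b"
  unfolding jacobsthal_def using assms
  by (intro sum.cong arg_cong2[of _ _ _ _ "(*)"] chi_cong cong_diff cong_refl) auto

lemma jacobsthal_0: "jacobsthal 0 = 0"
proof -
  have "chi t * chi (t\<^sup>2 - 0) = chi t" for t
    using chi_power_odd[of 3 t] by (simp add: chi_mult power2_eq_square power3_eq_cube)
  thus ?thesis
    by (simp only: jacobsthal_def sum_chi)
qed

lemma jacobsthal_scale:
  assumes "\<not> int p dvd k"
  shows "jacobsthal (a * k\<^sup>2) = chi k * jacobsthal a"
proof -
  have "jacobsthal (a * k\<^sup>2) = (\<Sum>t\<in>{0..<int p}. (\<lambda>t. chi t * chi (t\<^sup>2 - a * k\<^sup>2)) (k * t + 0))"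
    unfolding jacobsthal_def using assms
    by (intro sum_residues_affine[symmetric])
       (auto intro!: arg_cong2[of _ _ _ _ "(*)"] chi_cong cong_diff cong_pow)
  also have "\<dots> = (\<Sum>t\<in>{0..<int p}. chi k * (chi t * chi (t\<^sup>2 - a)))"
  proof (intro sum.cong refl)
    fix t
    have "(k * t + 0)\<^sup>2 - a * k\<^sup>2 = k\<^sup>2 * (t\<^sup>2 - a)"
      by (simp add: algebra_simps power_mult_distrib)
    hence "chi ((k * t + 0)\<^sup>2 - a * k\<^sup>2) = (chi k)\<^sup>2 * chi (t\<^sup>2 - a)"
      by (simp only: chi_mult power2_eq_square)
    thus "(\<lambda>t. chi t * chi (t\<^sup>2 - a * k\<^sup>2)) (k * t + 0) = chi k * (chi t * chi (t\<^sup>2 - a))"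
      using chi_square[OF assms] by (simp add: chi_mult)
  qed
  finally show ?thesis
    by (simp add: jacobsthal_def sum_distrib_left)
qed

text \<open>With ab congruent to k^2, the arguments a b^2 and b k^2 agree modulo \<open>p\<close>;
  scaling from \<open>a\<close> and from \<open>b\<close> changes the sums by signs only.\<close>

lemma jacobsthal_square_eq_if_residue:
  assumes "chi (a * b) = 1"
  shows "(jacobsthal a)\<^sup>2 = (jacobsthal b)\<^sup>2"
proof -
  have nz: "\<not> int p dvd a * b" "\<not> int p dvd b"
    using assms chi_eq_0_iff[of "a * b"] by auto
  have "QuadRes (int p) (a * b)"
    using assms by (auto simp: Legendre_def split: if_splits)
  then obtain k where k: "[k\<^sup>2 = a * b] (mod int p)"
    by (auto simp: QuadRes_def)
  have "\<not> int p dvd k"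
    using nz(1) cong_dvd_iff[OF k] by (auto simp: power2_eq_square)
  have "chi b * jacobsthal a = jacobsthal (a * b\<^sup>2)"
    using jacobsthal_scale[OF nz(2)] by simp
  also have "\<dots> = jacobsthal (b * k\<^sup>2)"
    using cong_scalar_left[OF k, of b]
    by (intro jacobsthal_cong) (simp add: power2_eq_square mult_ac cong_sym_eq)
  also have "\<dots> = chi k * jacobsthal b"
    by (rule jacobsthal_scale) fact
  finally have "(chi b * jacobsthal a)\<^sup>2 = (chi k * jacobsthal b)\<^sup>2"
    by simp
  thus ?thesis
    using chi_square[OF nz(2)] chi_square[OF \<open>\<not> int p dvd k\<close>] by (simp add: power_mult_distrib)
qed

end

section \<open>Second moment of Jacobsthal sums and p as a sum of two squares\<close>

context prime_1_mod_4
begin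

lemma chi_minus_1: "chi (-1) = 1"
  using sign_cong_imp_eq[OF chi_values[of "-1"], of 1] chi_euler[of "-1"] by (simp add: n_eq)

lemma chi_reflect: "chi (int p - t) = chi t"
proof -
  have "chi (int p - t) = chi ((-1) * t)"
    by (intro chi_cong) (simp add: cong_iff_dvd_diff)
  thus ?thesis
    by (simp only: chi_mult chi_minus_1 mult_1_left)
qed

text \<open>Expand the square and sum over \<open>a\<close> first. The inner sum is -1, plus
  \<open>p\<close> when u = t or u = -t; the part from -1 cancels, and each nonzero \<open>t\<close>
  contributes 2p because \<open>chi (-1) = 1\<close>.\<close>

lemma sum_jacobsthal_square: "(\<Sum>a\<in>{0..<int p}. (jacobsthal a)\<^sup>2) = 2 * int p * (int p - 1)"
proof -
  let ?R = "{0..<int p}"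
  have "(\<Sum>a\<in>?R. (jacobsthal a)\<^sup>2) =
      (\<Sum>a\<in>?R. \<Sum>t\<in>?R. \<Sum>u\<in>?R. chi t * chi u * (chi (t\<^sup>2 - a) * chi (u\<^sup>2 - a)))"
    unfolding jacobsthal_def power2_eq_square[of "sum _ _"] sum_product
    by (intro sum.cong refl) (simp only: mult_ac)
  also have "\<dots> = (\<Sum>t\<in>?R. \<Sum>a\<in>?R. \<Sum>u\<in>?R. chi t * chi u * (chi (t\<^sup>2 - a) * chi (u\<^sup>2 - a)))"
    by (rule sum.swap)
  also have "\<dots> = (\<Sum>t\<in>?R. \<Sum>u\<in>?R. \<Sum>a\<in>?R. chi t * chi u * (chi (t\<^sup>2 - a) * chi (u\<^sup>2 - a)))"
    by (intro sum.cong refl sum.swap)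
  also have "\<dots> = (\<Sum>t\<in>?R. \<Sum>u\<in>?R. int p * (if int p dvd t\<^sup>2 - u\<^sup>2 then chi t * chi u else 0)
      - chi t * chi u)"
    unfolding sum_distrib_left[symmetric] sum_chi_quadratic
    by (intro sum.cong refl) (simp add: algebra_simps)
  also have "\<dots> = int p * (\<Sum>t\<in>?R. \<Sum>u\<in>?R. if int p dvd t\<^sup>2 - u\<^sup>2 then chi t * chi u else 0)
      - (\<Sum>t\<in>?R. \<Sum>u\<in>?R. chi t * chi u)"
    by (simp add: sum_subtractf sum_distrib_left)
  also have "(\<Sum>t\<in>?R. \<Sum>u\<in>?R. chi t * chi u) = 0"
    by (simp add: sum_chi flip: sum_distrib_left)
  also have "(\<Sum>t\<in>?R. \<Sum>u\<in>?R. if int p dvd t\<^sup>2 - u\<^sup>2 then chi t * chi u else 0) =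
      (\<Sum>t\<in>{1..<int p}. \<Sum>u\<in>?R. if int p dvd t\<^sup>2 - u\<^sup>2 then chi t * chi u else 0)"
    by (rule sum_nonzero_residues) (auto intro!: sum.neutral simp: chi_0)
  also have "\<dots> = (\<Sum>t\<in>{1..<int p}. 2)"
  proof (intro sum.cong refl)
    fix t assume t: "t \<in> {1..<int p}"
    have "{u \<in> ?R. int p dvd t\<^sup>2 - u\<^sup>2} = {t, int p - t}"
    proof (intro equalityI subsetI)
      fix u assume u: "u \<in> {u \<in> ?R. int p dvd t\<^sup>2 - u\<^sup>2}"
      hence "int p dvd (t - u) * (t + u)"
        by (simp add: power2_eq_square algebra_simps)
      hence "int p dvd t - u \<or> int p dvd t + u"
        using prime_int_p by (simp add: prime_dvd_mult_iff)
      thus "u \<in> {t, int p - t}"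
      proof
        assume "int p dvd t - u"
        hence "t mod int p = u mod int p"
          by (simp add: mod_eq_dvd_iff)
        thus ?thesis
          using t u by simp
      next
        assume "int p dvd t + u"
        then obtain c where c: "t + u = int p * c"
          by auto
        have "0 < int p * c" "int p * c < int p * 2"
          unfolding c[symmetric] using t u by auto
        hence "0 < c"
          by (simp add: zero_less_mult_iff)
        moreover have "c < 2"
          using \<open>int p * c < int p * 2\<close> by (rule mult_left_less_imp_less) simp
        ultimately have "c = 1"
          by simp
        thus ?thesis
          using c by simp
      qed
    next
      fix u assume u: "u \<in> {t, int p - t}"
      moreover have "t\<^sup>2 - (int p - t)\<^sup>2 = int p * (2 * t - int p)"
        by (simp add: power2_eq_square algebra_simps)
      ultimately show "u \<in> {u \<in> ?R. int p dvd t\<^sup>2 - u\<^sup>2}"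
        using t by auto
    qed
    hence "(\<Sum>u\<in>?R. if int p dvd t\<^sup>2 - u\<^sup>2 then chi t * chi u else 0) =
        (\<Sum>u\<in>{t, int p - t}. chi t * chi u)"
      by (simp flip: sum.inter_filter)
    also have "t \<noteq> int p - t"
      using int_p_eq by presburger
    hence "(\<Sum>u\<in>{t, int p - t}. chi t * chi u) = 2 * (chi t)\<^sup>2"
      by (simp add: chi_reflect power2_eq_square)
    also have "\<dots> = 2"
      using chi_square not_dvd_residue[OF t] by simp
    finally show "(\<Sum>u\<in>?R. if int p dvd t\<^sup>2 - u\<^sup>2 then chi t * chi u else 0) = 2" .
  qed
  finally show ?thesis
    using p_gt_2 by simp
qed

text \<open>On nonzero residues the square of \<open>jacobsthal\<close> takes only its values at 1
  and \<open>g\<close>, each equally often, so their sum follows from the second moment.\<close>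

lemma jacobsthal_sum_squares:
  assumes "chi g = -1"
  shows "(jacobsthal 1)\<^sup>2 + (jacobsthal g)\<^sup>2 = 4 * int p"
proof -
  have "2 * (2 * int p * (int p - 1)) = (\<Sum>a\<in>{1..<int p}. 2 * (jacobsthal a)\<^sup>2)"
    unfolding sum_jacobsthal_square[symmetric]
    by (subst sum_nonzero_residues) (simp_all add: jacobsthal_0 sum_distrib_left)
  \<comment> \<open>One formula interpolates both values through \<open>chi a\<close>; its variable
    part then sums to 0.\<close>
  also have "\<dots> = (\<Sum>a\<in>{1..<int p}. ((jacobsthal 1)\<^sup>2 + (jacobsthal g)\<^sup>2) +
      chi a * ((jacobsthal 1)\<^sup>2 - (jacobsthal g)\<^sup>2))"
  proof (intro sum.cong refl)
    fix a assume "a \<in> {1..<int p}"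
    hence "chi a \<noteq> 0"
      by (simp add: chi_eq_0_iff not_dvd_residue)
    then consider "chi a = 1" | "chi a = -1"
      using chi_values[of a] by blast
    thus "2 * (jacobsthal a)\<^sup>2 = ((jacobsthal 1)\<^sup>2 + (jacobsthal g)\<^sup>2) +
        chi a * ((jacobsthal 1)\<^sup>2 - (jacobsthal g)\<^sup>2)"
    proof cases
      case 1
      thus ?thesis
        using jacobsthal_square_eq_if_residue[of a 1] by simp
    next
      case 2
      thus ?thesis
        using jacobsthal_square_eq_if_residue[of a g] assms by (simp add: chi_mult)
    qed
  qed
  also have "\<dots> = (int p - 1) * ((jacobsthal 1)\<^sup>2 + (jacobsthal g)\<^sup>2) +
      (\<Sum>a\<in>{1..<int p}. chi a) * ((jacobsthal 1)\<^sup>2 - (jacobsthal g)\<^sup>2)"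
    using p_gt_2 by (simp add: sum.distrib sum_distrib_right)
  also have "(\<Sum>a\<in>{1..<int p}. chi a) = 0"
    using sum_chi sum_nonzero_residues[of chi] by (simp add: chi_eq_0_iff)
  finally have "(int p - 1) * (4 * int p) = (int p - 1) * ((jacobsthal 1)\<^sup>2 + (jacobsthal g)\<^sup>2)"
    by (simp add: algebra_simps)
  thus ?thesis
    using p_gt_2 by simp
qed

text \<open>The summand is invariant under t -> p - t because \<open>chi (-1) = 1\<close>.\<close>

lemma jacobsthal_half:
  "jacobsthal a = 2 * (\<Sum>t\<in>{1..int n}. chi t * chi (t\<^sup>2 - a))"
proof -
  define F where "F t = chi t * chi (t\<^sup>2 - a)" for t
  have F: "F (int p - t) = F t" for t
  proof -
    have "chi ((int p - t)\<^sup>2 - a) = chi (t\<^sup>2 - a)"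
      by (intro chi_cong) (simp add: cong_iff_dvd_diff power2_eq_square algebra_simps)
    thus ?thesis
      by (simp add: F_def chi_reflect)
  qed
  have F': "F (2 * int n + 1 - t) = F t" for t
    using F[of t] by (simp add: int_p_eq)
  have "jacobsthal a = (\<Sum>t\<in>{1..<int p}. F t)"
    unfolding jacobsthal_def F_def by (rule sum_nonzero_residues) (simp add: chi_0)
  also have "{1..<int p} = {1..int n} \<union> {int n + 1..2 * int n}"
    using int_p_eq by auto
  also have "(\<Sum>t\<in>\<dots>. F t) = (\<Sum>t\<in>{1..int n}. F t) + (\<Sum>t\<in>{int n + 1..2 * int n}. F t)"
    by (intro sum.union_disjoint) auto
  also have "(\<Sum>t\<in>{int n + 1..2 * int n}. F t) = (\<Sum>t\<in>{1..int n}. F t)"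
    by (rule sum.reindex_bij_witness[of _ "\<lambda>t. int p - t" "\<lambda>t. int p - t"])
      (use int_p_eq F in \<open>auto simp: F'\<close>)
  finally show ?thesis
    by (simp add: F_def)
qed

text \<open>The term t = 1 vanishes and the other n - 1 terms are signs, with \<open>n\<close> even.
  This parity singles out the square matched with \<open>x\<^sup>2\<close>.\<close>

lemma odd_jacobsthal_half: "odd (\<Sum>t\<in>{1..int n}. chi t * chi (t\<^sup>2 - 1))"
proof -
  have "{1..int n} = insert 1 {2..int n}"
    using n_pos by auto
  hence "(\<Sum>t\<in>{1..int n}. chi t * chi (t\<^sup>2 - 1)) = (\<Sum>t\<in>{2..int n}. chi t * chi (t\<^sup>2 - 1))"
    by (simp add: chi_eq_0_iff)
  also have "[\<dots> = (\<Sum>t\<in>{2..int n}. 1)] (mod 2)"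
  proof (intro cong_sum)
    fix t assume t: "t \<in> {2..int n}"
    hence "\<not> int p dvd t" "\<not> int p dvd t - 1" "\<not> int p dvd t + 1"
      using int_p_eq by (auto dest: zdvd_imp_le)
    moreover have "t\<^sup>2 - 1 = (t - 1) * (t + 1)"
      by (simp add: power2_eq_square algebra_simps)
    ultimately have "\<not> int p dvd t * (t\<^sup>2 - 1)"
      using prime_int_p by (simp only: prime_dvd_mult_iff) simp
    hence "chi (t * (t\<^sup>2 - 1)) \<noteq> 0"
      by (simp only: chi_eq_0_iff not_False_eq_True)
    hence "chi (t * (t\<^sup>2 - 1)) = 1 \<or> chi (t * (t\<^sup>2 - 1)) = -1"
      using chi_values by blast
    thus "[chi t * chi (t\<^sup>2 - 1) = 1] (mod 2)"
      unfolding chi_mult[symmetric] by (auto simp: cong_iff_dvd_diff)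
  qed
  also have "(\<Sum>t\<in>{2..int n}. 1) = int n - 1"
    using n_pos by simp
  finally show ?thesis
    using n_eq n_pos by (auto simp: cong_iff_dvd_diff)
qed

lemma jacobsthal_1_square:
  assumes "int p = x\<^sup>2 + 4 * y\<^sup>2"
  shows "(jacobsthal 1)\<^sup>2 = 4 * x\<^sup>2"
proof -
  obtain g where g: "chi g = -1"
    using ex_nonresidue by blast
  obtain s r where s: "jacobsthal 1 = 2 * s" "odd s" and r: "jacobsthal g = 2 * r"
    using jacobsthal_half odd_jacobsthal_half by blast
  have "int p = s\<^sup>2 + r\<^sup>2"
    using jacobsthal_sum_squares[OF g] by (simp add: s r power_mult_distrib)
  moreover have "int p = x\<^sup>2 + (2 * y)\<^sup>2"
    using assms by (simp add: power_mult_distrib)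
  moreover have "odd (int p)"
    using odd_p by simp
  moreover have "odd x"
    using \<open>odd (int p)\<close> assms by auto
  ultimately have "s\<^sup>2 = x\<^sup>2"
    using prime_sum_two_squares_unique[OF prime_int_p] s(2) by blast
  thus ?thesis
    by (simp add: s power_mult_distrib)
qed

end

section \<open>The Jacobsthal sum modulo the square of the prime\<close>

context odd_prime
begin

text \<open>In a^p - b^p = (a - b) S the factor S is a sum of \<open>p\<close> terms congruent to
  each other, so \<open>p\<close> divides both factors. Raising to the power \<open>p\<close> thus
  lifts congruences to \<open>p\<^sup>2\<close>.\<close>

lemma power_p_cong:
  fixes a b :: int
  assumes "[a = b] (mod int p)"
  shows "[a ^ p = b ^ p] (mod (int p)\<^sup>2)"
proof -
  have "[(\<Sum>k<p. a ^ k * b ^ (2 * n - k)) = (\<Sum>k<p. b ^ (2 * n))] (mod int p)"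
  proof (rule cong_sum)
    fix k assume "k \<in> {..<p}"
    hence "b ^ k * b ^ (2 * n - k) = b ^ (2 * n)"
      by (simp add: p_eq flip: power_add)
    moreover have "[a ^ k * b ^ (2 * n - k) = b ^ k * b ^ (2 * n - k)] (mod int p)"
      using assms by (intro cong_mult cong_pow cong_refl)
    ultimately show "[a ^ k * b ^ (2 * n - k) = b ^ (2 * n)] (mod int p)"
      by simp
  qed
  hence "int p dvd (\<Sum>k<p. a ^ k * b ^ (2 * n - k))"
    by (simp add: cong_dvd_iff)
  moreover have "int p dvd a - b"
    using assms by (simp add: cong_iff_dvd_diff)
  moreover have "a ^ p - b ^ p = (a - b) * (\<Sum>k<p. a ^ k * b ^ (2 * n - k))"
    using diff_power_eq_sum[of a "2 * n" b] by (simp add: p_eq)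
  ultimately show ?thesis
    unfolding cong_iff_dvd_diff power2_eq_square by (simp add: mult_dvd_mono)
qed

lemma fermat_int: "[t ^ p = t] (mod int p)"
proof -
  have "[t ^ p = t * (t ^ n)\<^sup>2] (mod int p)"
    by (simp add: p_eq power_even_eq)
  also have "[t * (t ^ n)\<^sup>2 = t * (chi t)\<^sup>2] (mod int p)"
    by (intro cong_mult cong_pow cong_refl cong_sym[OF chi_euler])
  also have "[t * (chi t)\<^sup>2 = t] (mod int p)"
    using chi_square[of t] chi_eq_0_iff[of t] by (cases "int p dvd t") (auto simp: cong_0_iff cong_sym_eq[of 0])
  finally show ?thesis .
qed

text \<open>Modulo \<open>p\<^sup>2\<close> the powers \<open>t ^ p\<close> act like (p-1)-th roots
  of unity. Scaling by a generator multiplies the sum by a factor that differs from 1 by a unit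
  unless p - 1 divides \<open>j\<close>.\<close>

lemma sum_power_p_cong:
  "[(\<Sum>t\<in>{1..<int p}. (t ^ p) ^ j) = (if 2 * n dvd j then 2 * int n else 0)] (mod (int p)\<^sup>2)"
proof (cases "2 * n dvd j")
  case True
  then obtain i where i: "j = 2 * n * i"
    by auto
  have "[(\<Sum>t\<in>{1..<int p}. (t ^ p) ^ j) = (\<Sum>t\<in>{1..<int p}. 1)] (mod (int p)\<^sup>2)"
  proof (rule cong_sum)
    fix t assume t: "t \<in> {1..<int p}"
    have "[(t ^ n)\<^sup>2 = (chi t)\<^sup>2] (mod int p)"
      by (intro cong_pow cong_sym[OF chi_euler])
    hence "[t ^ (2 * n) = 1] (mod int p)"
      by (simp add: chi_square not_dvd_residue[OF t] power_even_eq)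
    hence "[((t ^ (2 * n)) ^ p) ^ i = (1 ^ p) ^ i] (mod (int p)\<^sup>2)"
      by (intro cong_pow power_p_cong)
    thus "[(t ^ p) ^ j = 1] (mod (int p)\<^sup>2)"
      by (simp add: i mult_ac flip: power_mult)
  qed
  thus ?thesis
    using True int_p_eq n_pos by simp
next
  case False
  obtain g where g: "\<not> int p dvd g" "\<And>j. [g ^ j = 1] (mod int p) \<Longrightarrow> (p - 1) dvd j"
    using ex_generator by blast
  have j: "j \<noteq> 0"
    using False by (metis dvd_0_right)
  \<comment> \<open>Reducing \<open>t\<close> first makes \<open>F\<close> exactly periodic, as the
    affine substitution requires.\<close>
  define F where "F t = (t mod int p) ^ (p * j)" for t
  have F: "[F t = (t ^ p) ^ j] (mod (int p)\<^sup>2)" for t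
    unfolding F_def power_mult by (intro cong_pow power_p_cong) (simp add: cong_def)
  define S where "S = (\<Sum>t\<in>{0..<int p}. F t)"
  have S: "S = (\<Sum>t\<in>{1..<int p}. (t ^ p) ^ j)"
    unfolding S_def using j p_gt_2
    by (subst sum_nonzero_residues) (auto simp: F_def power_mult intro!: sum.cong)
  have "[S = (\<Sum>t\<in>{0..<int p}. F (g * t + 0))] (mod (int p)\<^sup>2)"
    unfolding S_def by (subst sum_residues_affine[OF _ g(1)]) (auto simp: F_def)
  also have "[(\<Sum>t\<in>{0..<int p}. F (g * t + 0)) = (\<Sum>t\<in>{0..<int p}. (g ^ p) ^ j * F t)] (mod (int p)\<^sup>2)"
  proof (rule cong_sum)
    fix t
    have "[F (g * t + 0) = (g ^ p) ^ j * (t ^ p) ^ j] (mod (int p)\<^sup>2)"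
      using F[of "g * t + 0"] by (simp add: power_mult_distrib)
    also have "[(g ^ p) ^ j * (t ^ p) ^ j = (g ^ p) ^ j * F t] (mod (int p)\<^sup>2)"
      by (intro cong_mult cong_refl cong_sym[OF F])
    finally show "[F (g * t + 0) = (g ^ p) ^ j * F t] (mod (int p)\<^sup>2)" .
  qed
  finally have "[S = (g ^ p) ^ j * S] (mod (int p)\<^sup>2)"
    by (simp add: S_def sum_distrib_left)
  hence "[((g ^ p) ^ j - 1) * S = ((g ^ p) ^ j - 1) * 0] (mod (int p)\<^sup>2)"
    by (simp add: cong_iff_dvd_diff dvd_diff_commute left_diff_distrib)
  moreover have "coprime ((g ^ p) ^ j - 1) (int p)"
  proof -
    have "\<not> [g ^ j = 1] (mod int p)"
      using g(2)[of j] False p_eq by auto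
    moreover have "[(g ^ p) ^ j = g ^ j] (mod int p)"
      by (intro cong_pow fermat_int)
    ultimately have "\<not> int p dvd (g ^ p) ^ j - 1"
      by (metis cong_iff_dvd_diff cong_sym cong_trans)
    thus ?thesis
      by (simp only: prime_imp_coprime[OF prime_int_p] coprime_commute[of _ "int p"] not_False_eq_True)
  qed
  ultimately have "[S = 0] (mod (int p)\<^sup>2)"
    by (rule cong_cancel_p2)
  thus ?thesis
    using False S by simp
qed

text \<open>
  The map \<open>y \<mapsto> (3y - y\<^sup>3) / 2\<close> is the Newton step for \<open>y\<^sup>2 = 1\<close>, so it squares the error of
  \<open>a^n\<close> as an approximation to \<open>\<chi>(a)\<close>.
\<close>

lemma twice_chi_cong:
  assumes "2 \<le> n"
  shows "[2 * chi a = 3 * a ^ n - a ^ (3 * n)] (mod (int p)\<^sup>2)"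
proof (cases "int p dvd a")
  case True
  \<comment> \<open>Here \<open>chi a\<close> is 0, and \<open>2 \<le> n\<close> makes both powers
    of \<open>a\<close> vanish modulo \<open>p\<^sup>2\<close>.\<close>
  hence "(int p)\<^sup>2 dvd a ^ n"
    using assms by (meson dvd_power_le)
  moreover from this have "(int p)\<^sup>2 dvd a ^ (3 * n)"
    by (rule dvd_trans) (simp add: le_imp_power_dvd)
  ultimately show ?thesis
    using True chi_eq_0_iff[of a] by (simp add: cong_iff_dvd_diff)
next
  case False
  obtain c where c: "a ^ n = chi a + int p * c"
    using chi_euler[of a] by (auto simp: cong_iff_lin cong_sym_eq)
  have sq: "(chi a)\<^sup>2 = 1"
    using chi_square[OF False] .
  have "3 * a ^ n - a ^ (3 * n) - 2 * chi a = 3 * a ^ n - (a ^ n) ^ 3 - 2 * chi a"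
    by (simp add: mult.commute flip: power_mult)
  also have "\<dots> = (1 - (chi a)\<^sup>2) * (chi a + 3 * int p * c) - (int p)\<^sup>2 * (c\<^sup>2 * (3 * chi a + int p * c))"
    unfolding c by (simp add: power2_eq_square power3_eq_cube algebra_simps)
  finally show ?thesis
    by (simp add: sq cong_iff_dvd_diff dvd_diff_commute[of _ "2 * chi a"])
qed

end

section \<open>Evaluation of the Jacobsthal sum through binomial coefficients\<close>

context prime_1_mod_4
begin

definition moment :: "nat \<Rightarrow> int" where
  "moment N = (\<Sum>t\<in>{1..<int p}. (t ^ p) ^ n * ((t ^ p)\<^sup>2 - 1) ^ N)"

text \<open>After binomial expansion only exponents n + 2k = 2(h + k) divisible by p - 1 = 2n
  survive the sum over \<open>t\<close>.\<close>

lemma moment_cong: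
  assumes "even N"
  shows "[moment N = 2 * int n * (\<Sum>k | k \<le> N \<and> n dvd h + k. (-1) ^ k * int (N choose k))] (mod (int p)\<^sup>2)"
proof -
  have "moment N = (\<Sum>t\<in>{1..<int p}. \<Sum>k\<le>N. (-1) ^ k * int (N choose k) * (t ^ p) ^ (n + 2 * k))"
    unfolding moment_def
  proof (intro sum.cong refl)
    fix t :: int
    have "((t ^ p)\<^sup>2 - 1) ^ N = (\<Sum>k\<le>N. (-1) ^ k * int (N choose k) * (t ^ p) ^ (2 * k))"
      unfolding diff_conv_add_uminus binomial_ring using assms
      by (intro sum.cong refl) (auto simp: minus_one_power_iff mult_ac simp flip: power_mult)
    thus "(t ^ p) ^ n * ((t ^ p)\<^sup>2 - 1) ^ N =
        (\<Sum>k\<le>N. (-1) ^ k * int (N choose k) * (t ^ p) ^ (n + 2 * k))"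
      by (simp add: sum_distrib_left power_add mult_ac)
  qed
  also have "\<dots> = (\<Sum>k\<le>N. (-1) ^ k * int (N choose k) * (\<Sum>t\<in>{1..<int p}. (t ^ p) ^ (n + 2 * k)))"
    unfolding sum_distrib_left by (rule sum.swap)
  also have "[\<dots> = (\<Sum>k\<le>N. (-1) ^ k * int (N choose k) *
      (if 2 * n dvd n + 2 * k then 2 * int n else 0))] (mod (int p)\<^sup>2)"
    by (intro cong_sum cong_mult cong_refl sum_power_p_cong)
  also have "(\<Sum>k\<le>N. (-1) ^ k * int (N choose k) * (if 2 * n dvd n + 2 * k then 2 * int n else 0)) =
      (\<Sum>k\<le>N. if n dvd h + k then 2 * int n * ((-1) ^ k * int (N choose k)) else 0)"
  proof (intro sum.cong refl)
    fix k
    have "2 * n dvd n + 2 * k \<longleftrightarrow> 2 * n dvd 2 * (h + k)"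
      by (simp add: n_eq)
    also have "\<dots> \<longleftrightarrow> n dvd h + k"
      by (rule nat_mult_dvd_cancel1) simp
    finally show "(-1) ^ k * int (N choose k) * (if 2 * n dvd n + 2 * k then 2 * int n else 0) =
        (if n dvd h + k then 2 * int n * ((-1) ^ k * int (N choose k)) else 0)"
      by simp
  qed
  also have "\<dots> = 2 * int n * (\<Sum>k | k \<le> N \<and> n dvd h + k. (-1) ^ k * int (N choose k))"
    by (simp add: sum_distrib_left flip: sum.inter_filter)
  finally show ?thesis .
qed

lemma moment_2h: "[moment (2 * h) = 2 * int n * ((-1) ^ h * int ((2 * h) choose h))] (mod (int p)\<^sup>2)"
proof -
  have "{k. k \<le> 2 * h \<and> n dvd h + k} = {h}"
  proof (intro equalityI subsetI)
    fix k assume "k \<in> {k. k \<le> 2 * h \<and> n dvd h + k}"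
    then obtain c where c: "h + k = 2 * h * c" "k \<le> 2 * h"
      by (auto simp: n_eq)
    have "0 < c"
      using c(1) h_pos by (cases c) auto
    have "h * (2 * c) = h + k"
      using c(1) by simp
    hence "h * (2 * c) \<le> h * 3"
      using c(2) by linarith
    hence "c = 1"
      using h_pos \<open>0 < c\<close> by simp
    thus "k \<in> {h}"
      using c by simp
  qed (simp add: n_eq flip: mult_2)
  thus ?thesis
    using moment_cong[of "2 * h"] by simp
qed

lemma moment_6h: "[moment (6 * h) = 2 * int n *
    ((-1) ^ h * (2 * int ((6 * h) choose h) + int ((6 * h) choose (3 * h))))] (mod (int p)\<^sup>2)"
proof -
  \<comment> \<open>h + k lies between h and 7h, where the multiples of n = 2h are 2h, 4h and
    6h.\<close>
  have "{k. k \<le> 6 * h \<and> n dvd h + k} = {h, 3 * h, 5 * h}"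
  proof (intro equalityI subsetI)
    fix k assume "k \<in> {k. k \<le> 6 * h \<and> n dvd h + k}"
    then obtain c where c: "h + k = 2 * h * c" "k \<le> 6 * h"
      by (auto simp: n_eq)
    have "0 < c"
      using c(1) h_pos by (cases c) auto
    have "h * (2 * c) = h + k"
      using c(1) by simp
    hence "h * (2 * c) \<le> h * 7"
      using c(2) by linarith
    hence "c \<in> {1, 2, 3}"
      using h_pos \<open>0 < c\<close> by auto
    thus "k \<in> {h, 3 * h, 5 * h}"
      using c by auto
  next
    fix k assume "k \<in> {h, 3 * h, 5 * h}"
    then consider "k = h" "h + k = n * 1" | "k = 3 * h" "h + k = n * 2" | "k = 5 * h" "h + k = n * 3"
      by (auto simp: n_eq)
    thus "k \<in> {k. k \<le> 6 * h \<and> n dvd h + k}"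
      by cases (simp_all only: dvd_triv_left mem_Collect_eq, simp_all)
  qed
  moreover have "(6 * h) choose (5 * h) = (6 * h) choose h"
    using binomial_symmetric[of h "6 * h"] by simp
  moreover have "(-1) ^ (3 * h) = ((-1) ^ h :: int)" "(-1) ^ (5 * h) = ((-1) ^ h :: int)"
    by (auto simp: minus_one_power_iff)
  ultimately show ?thesis
    using moment_cong[of "6 * h"] h_pos by (simp add: algebra_simps)
qed

lemma twice_jacobsthal_cong: "[2 * jacobsthal 1 = 3 * moment (2 * h) - moment (6 * h)] (mod (int p)\<^sup>2)"
proof -
  have "2 * jacobsthal 1 = (\<Sum>t\<in>{1..<int p}. chi t * (2 * chi (t\<^sup>2 - 1)))"
    unfolding jacobsthal_def
    by (subst sum_nonzero_residues) (simp_all add: chi_0 sum_distrib_left mult_ac)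
  also have "[\<dots> = (\<Sum>t\<in>{1..<int p}. (t ^ p) ^ n *
      (3 * ((t ^ p)\<^sup>2 - 1) ^ n - ((t ^ p)\<^sup>2 - 1) ^ (3 * n)))] (mod (int p)\<^sup>2)"
  proof (intro cong_sum cong_mult)
    fix t
    \<comment> \<open>As \<open>p\<close> is odd, \<open>chi t ^ p\<close> equals
      \<open>chi t\<close>, so Euler's criterion lifts to \<open>p\<^sup>2\<close>.\<close>
    have "[chi t ^ p = (t ^ n) ^ p] (mod (int p)\<^sup>2)"
      by (intro power_p_cong chi_euler)
    thus "[chi t = (t ^ p) ^ n] (mod (int p)\<^sup>2)"
      using chi_power_odd[OF odd_p, of t] by (simp add: mult.commute flip: power_mult)
    \<comment> \<open>By Fermat \<open>t\<close> may become \<open>t ^ p\<close> here before the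
      Newton step, so that only powers of \<open>t ^ p\<close> occur.\<close>
    have "chi (t\<^sup>2 - 1) = chi ((t ^ p)\<^sup>2 - 1)"
      by (intro chi_cong cong_diff cong_pow cong_refl cong_sym[OF fermat_int])
    thus "[2 * chi (t\<^sup>2 - 1) = 3 * ((t ^ p)\<^sup>2 - 1) ^ n - ((t ^ p)\<^sup>2 - 1) ^ (3 * n)] (mod (int p)\<^sup>2)"
      using twice_chi_cong[of "(t ^ p)\<^sup>2 - 1"] h_pos n_eq by simp
  qed
  also have "(\<Sum>t\<in>{1..<int p}. (t ^ p) ^ n *
      (3 * ((t ^ p)\<^sup>2 - 1) ^ n - ((t ^ p)\<^sup>2 - 1) ^ (3 * n))) = 3 * moment n - moment (3 * n)"
    by (simp add: moment_def right_diff_distrib sum_subtractf sum_distrib_left mult_ac)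
  finally show ?thesis
    by (simp add: n_eq)
qed

text \<open>The evaluations combine to 2T + 2D = ePg modulo \<open>P\<^sup>2\<close>, while 2Deg =
  -4 modulo \<open>P\<close>; multiplying the first by 2D gives TD = -(D^2 + P) modulo
  \<open>P\<^sup>2\<close>, which is then squared and divided by D^2.\<close>

lemma delannoy_square_cong: "[delannoy\<^sup>2 = (jacobsthal 1)\<^sup>2 - 2 * int p] (mod (int p)\<^sup>2)"
proof -
  define P where "P = int p"
  define e :: int where "e = (-1) ^ h"
  define A where "A = int ((2 * h) choose h)"
  define B where "B = int ((6 * h) choose h)"
  define C where "C = int ((3 * h) choose h)"
  define D where "D = delannoy"
  define T where "T = jacobsthal 1"
  obtain g where g: "int ((6 * h) choose (3 * h)) = P * g" and Ag: "[A * g = -2] (mod P)"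
    using binomial_6h_3h unfolding A_def P_def by blast
  have ee: "e * e = 1"
    by (simp add: e_def flip: power_mult_distrib)
  have P: "2 * int n = P - 1"
    by (simp add: P_def int_p_eq)
  obtain u where u: "2 * D = e * A + C + P\<^sup>2 * u"
    using twice_delannoy_cong unfolding D_def e_def A_def C_def P_def
    by (metis cong_iff_lin cong_sym)
  obtain v where v: "2 * B = 2 * A - e * C - 2 * P * A + P\<^sup>2 * v"
    using binomial_6h_h_cong unfolding B_def e_def A_def C_def P_def
    by (metis cong_iff_lin cong_sym)
  obtain w where w: "e * C = A + P * w"
    using binomial_2h_h_cong unfolding e_def A_def C_def P_def
    by (metis cong_iff_lin)
  obtain z where z: "A * g = -2 + P * z"
    using Ag by (metis cong_iff_lin cong_sym)
  have "[2 * T = (P - 1) * (e * (3 * A - 2 * B - P * g))] (mod P\<^sup>2)"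
  proof -
    have "[2 * T = 3 * moment (2 * h) - moment (6 * h)] (mod P\<^sup>2)"
      using twice_jacobsthal_cong by (simp add: T_def P_def)
    also have "[3 * moment (2 * h) - moment (6 * h) =
        3 * (2 * int n * (e * A)) - 2 * int n * (e * (2 * B + P * g))] (mod P\<^sup>2)"
      using moment_2h moment_6h unfolding g P_def e_def A_def B_def
      by (intro cong_diff cong_mult cong_refl)
    finally show ?thesis
      unfolding P by (simp add: algebra_simps)
  qed
  then obtain y where y: "2 * T = (P - 1) * (e * (3 * A - 2 * B - P * g)) + P\<^sup>2 * y"
    by (metis cong_iff_lin cong_sym)
  have C: "C = e * (A + P * w)"
    using ee by (simp flip: w mult.assoc)
  have D: "2 * D = e * (2 * A + P * w) + P\<^sup>2 * u"
    unfolding u C by (simp add: algebra_simps)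
  \<comment> \<open>\<open>s\<close> collects the multiples of \<open>P\<^sup>2\<close> in 2T + 2D;
    at first order the terms 2AP cancel and only ePg is left.\<close>
  define s where "s = e * (w - g + 2 * A - (P - 1) * v) + y + u"
  have "3 * A - 2 * B - P * g = 2 * A + P * w + 2 * P * A - P\<^sup>2 * v - P * g"
    using v w by simp
  with y have "2 * T = (P - 1) * (e * (2 * A + P * w + 2 * P * A - P\<^sup>2 * v - P * g)) + P\<^sup>2 * y"
    by (simp only:)
  hence "2 * T = - (2 * D) + e * P * g + P\<^sup>2 * s"
    unfolding D s_def by (simp add: algebra_simps power2_eq_square)
  hence "2 * T + 2 * D = e * P * g + P\<^sup>2 * s"
    by simp
  moreover have "4 * (T * D + D\<^sup>2 + P) = 2 * D * (2 * T + 2 * D) + 4 * P"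
    by (simp add: algebra_simps power2_eq_square)
  ultimately have "4 * (T * D + D\<^sup>2 + P) = 2 * D * (e * P * g + P\<^sup>2 * s) + 4 * P"
    by (simp only:)
  moreover have eDg: "2 * D * (e * g) = - 4 + P * (2 * z + g * w + e * g * P * u)"
  proof -
    have "2 * D * (e * g) = (e * e) * (2 * (A * g) + P * g * w) + e * g * P\<^sup>2 * u"
      unfolding D by (simp add: algebra_simps)
    also have "\<dots> = - 4 + P * (2 * z + g * w + e * g * P * u)"
      unfolding ee z by (simp add: algebra_simps power2_eq_square)
    finally show ?thesis .
  qed
  have "2 * D * (e * P * g + P\<^sup>2 * s) + 4 * P = P * (2 * D * (e * g)) + P\<^sup>2 * (2 * D * s) + 4 * P"
    by (simp add: algebra_simps)
  hence "2 * D * (e * P * g + P\<^sup>2 * s) + 4 * P = P\<^sup>2 * (2 * z + g * w + e * g * P * u + 2 * D * s)"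
    unfolding eDg by (simp add: algebra_simps power2_eq_square)
  ultimately have "[4 * (T * D + D\<^sup>2 + P) = 4 * 0] (mod P\<^sup>2)"
    by (simp add: cong_0_iff)
  moreover have "coprime 4 (int p)"
    using coprime_power_left_iff[of "2 :: int" 2 "int p"] odd_p by simp
  ultimately have "[T * D + D\<^sup>2 + P = 0] (mod P\<^sup>2)"
    unfolding P_def by (rule cong_cancel_p2)
  then obtain x where "T * D + D\<^sup>2 + P = P\<^sup>2 * x"
    unfolding cong_0_iff by (elim dvdE)
  hence TD: "T * D = P\<^sup>2 * x - (D\<^sup>2 + P)"
    by simp
  have "D\<^sup>2 * D\<^sup>2 - D\<^sup>2 * (T\<^sup>2 - 2 * P) = (D\<^sup>2 + P)\<^sup>2 - (T * D)\<^sup>2 - P\<^sup>2"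
    by (simp add: algebra_simps power2_eq_square)
  also have "\<dots> = P\<^sup>2 * (2 * x * (D\<^sup>2 + P) - P\<^sup>2 * x\<^sup>2 - 1)"
    unfolding TD by (simp add: algebra_simps power2_eq_square)
  finally have "[D\<^sup>2 * D\<^sup>2 = D\<^sup>2 * (T\<^sup>2 - 2 * P)] (mod P\<^sup>2)"
    by (simp add: cong_iff_dvd_diff)
  \<comment> \<open>If \<open>P\<close> divided \<open>D\<close>, the congruence for 2Deg would make
    it divide 4, but P = 4h + 1 > 4.\<close>
  moreover have "\<not> P dvd D"
  proof
    assume "P dvd D"
    hence "P dvd 2 * D * (e * g)"
      by simp
    hence "P dvd 2 * D * (e * g) - P * (2 * z + g * w + e * g * P * u)"
      by (intro dvd_diff) auto
    hence "P dvd 4"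
      unfolding eDg by simp
    hence "P \<le> 4"
      by (rule zdvd_imp_le) simp
    thus False
      using h_pos by (simp add: P_def p_eq_h)
  qed
  hence "coprime P D"
    unfolding P_def by (rule prime_imp_coprime[OF prime_int_p])
  hence "coprime (D\<^sup>2) P"
    by (simp add: coprime_commute[of D])
  ultimately show ?thesis
    unfolding P_def D_def T_def by (rule cong_cancel_p2)
qed

end

theorem theorem3p5:
  fixes p :: nat
  assumes "prime p" and "odd p"
  shows "rat_cong p 1 (V_sum p 8) (V_sum p 32) \<and>
         (\<forall>x y :: int. p mod 4 = 1 \<and> int p = x\<^sup>2 + 4 * y\<^sup>2 \<longrightarrow>
            rat_cong p 1 (V_sum p 8) (of_int (4 * x\<^sup>2)) \<and>
            rat_cong p 1 (V_sum p 32) (of_int (4 * x\<^sup>2))) \<and>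
         (p mod 4 = 3 \<longrightarrow>
            rat_cong p 1 (V_sum p 8) 0 \<and>
            rat_cong p 1 (V_sum p 32) 0) \<and>
         (\<forall>x y :: int. p mod 4 = 1 \<and> int p = x\<^sup>2 + 4 * y\<^sup>2 \<longrightarrow>
            rat_cong p 2 (V_sum p (- 16)) (of_int (4 * x\<^sup>2 - 2 * int p))) \<and>
         (p mod 4 = 3 \<longrightarrow>
            rat_cong p 1 (V_sum p (- 16)) 0)"
proof -
  define n where "n = p div 2"
  interpret odd_prime p n
    by unfold_locales (use assms in \<open>auto simp: n_def\<close>)
  have two: "coprime (2 :: int) (int p)"
    using odd_p by simp
  \<comment> \<open>The bases 8, 32 and -16 are 2^3, 2^5 and -(2^4), so the denominators are prime
    to the odd \<open>p\<close>.\<close>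
  have coprime: "coprime (m ^ (2 * n)) (int p)" if "m = 2 ^ k \<or> m = - (2 ^ k)" for m :: int and k
    using that two by auto
  have coprimes: "coprime (8 ^ (2 * n)) (int p)" "coprime (32 ^ (2 * n)) (int p)"
    "coprime ((-16) ^ (2 * n)) (int p)"
    by (rule coprime[of _ 3], simp, rule coprime[of _ 5], simp, rule coprime[of _ 4], simp)
  have V_cong: "rat_cong p k (V_sum p m) (of_int b)"
    if "[V_num m = m ^ (2 * n) * delannoy\<^sup>2] (mod (int p ^ k))" "[delannoy\<^sup>2 = b] (mod (int p ^ k))"
      "coprime (m ^ (2 * n)) (int p)" "m \<noteq> 0" for m b k
  proof -
    have "[V_num m = m ^ (2 * n) * b] (mod (int p ^ k))"
      using cong_trans[OF that(1) cong_scalar_left[OF that(2)]] .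
    thus ?thesis
      using that(3,4) rat_cong_fractionI[of "m ^ (2 * n)" p 1 "V_num m" b k]
      by (simp add: V_sum_eq mult.commute)
  qed
  note V_8 = V_cong[of 8 1, simplified power_one_right, OF V_num_8 _ coprimes(1)]
  note V_32 = V_cong[of 32 1, simplified power_one_right, OF V_num_32 _ coprimes(2)]
  note V_minus_16 = V_cong[of "-16" 2, OF V_num_minus_16 _ coprimes(3)]
  note V_minus_16' = V_cong[of "-16" 1, simplified power_one_right,
      OF cong_p_if_p2[OF V_num_minus_16] _ coprimes(3)]
  \<comment> \<open>Both sums are congruent to the square of \<open>delannoy\<close>, whatever the
    residue of \<open>p\<close> modulo 4.\<close>
  have "rat_cong p 1 (V_sum p 8) (V_sum p 32)"
  proof -
    have "[V_num 8 * 32 ^ (2 * n) = 8 ^ (2 * n) * delannoy\<^sup>2 * 32 ^ (2 * n)] (mod int p)"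
      by (intro cong_mult cong_refl V_num_8)
    also have "8 ^ (2 * n) * delannoy\<^sup>2 * 32 ^ (2 * n) = (32 ^ (2 * n) * delannoy\<^sup>2) * 8 ^ (2 * n)"
      by (simp only: mult_ac)
    also have "[(32 ^ (2 * n) * delannoy\<^sup>2) * 8 ^ (2 * n) = V_num 32 * 8 ^ (2 * n)] (mod int p)"
      by (intro cong_mult cong_refl cong_sym[OF V_num_32])
    finally show ?thesis
      using rat_cong_fractionI[OF coprimes(1) _ coprimes(2), of "V_num 8" "V_num 32" 1]
      by (simp add: V_sum_eq)
  qed
  moreover have "rat_cong p 1 (V_sum p 8) (of_int (4 * x\<^sup>2)) \<and>
      rat_cong p 1 (V_sum p 32) (of_int (4 * x\<^sup>2)) \<and>
      rat_cong p 2 (V_sum p (- 16)) (of_int (4 * x\<^sup>2 - 2 * int p))"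
    if "p mod 4 = 1" "int p = x\<^sup>2 + 4 * y\<^sup>2" for x y
  proof -
    interpret prime_1_mod_4 p n "p div 4"
      by unfold_locales (use \<open>p mod 4 = 1\<close> in \<open>simp add: n_def; presburger\<close>)
    have D: "[delannoy\<^sup>2 = 4 * x\<^sup>2 - 2 * int p] (mod (int p)\<^sup>2)"
      using delannoy_square_cong jacobsthal_1_square[OF that(2)] by simp
    have "[4 * x\<^sup>2 - 2 * int p = 4 * x\<^sup>2] (mod int p)"
      by (simp add: cong_iff_dvd_diff)
    hence "[delannoy\<^sup>2 = 4 * x\<^sup>2] (mod int p)"
      using cong_trans[OF cong_p_if_p2[OF D]] by blast
    thus ?thesis
      using V_8[of "4 * x\<^sup>2"] V_32[of "4 * x\<^sup>2"] V_minus_16[OF D] by simp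
  qed
  moreover have "rat_cong p 1 (V_sum p 8) 0 \<and> rat_cong p 1 (V_sum p 32) 0 \<and>
      rat_cong p 1 (V_sum p (- 16)) 0" if "p mod 4 = 3"
  proof -
    have "odd n"
      using that unfolding n_def by presburger
    hence "[delannoy\<^sup>2 = 0] (mod int p)"
      using cong_pow[OF delannoy_cong_0, of 2] by simp
    thus ?thesis
      using V_8[of 0] V_32[of 0] V_minus_16'[of 0] by simp
  qed
  ultimately show ?thesis
    by blast
qed

end
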